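(* Let $(X,\|\cdot\|_X)$ be a Banach space. Let $(L,\mathrm{Dom}(L))$ be the generator of a strongly continuous contraction semigroup $(T_t)_{t\ge0}$ on $X$. Let the family $(F(t))_{t\ge0}$ of contractions on $X$ be strongly Borel measurable (i.e., for all $\varphi\in X$, the mappings $t\mapsto\|F(t)\varphi\|_X$ from $[0,\infty)$ to $\mathbb{R}$ are Borel measurable) and Chernoff equivalent to $(T_t)_{t\ge0}$. Let $f_0\in\mathrm{Dom}(L)$. Let $\mu$ be a finite (non-zero) Borel measure with $\mathrm{supp}\,\mu\subset(0,1)$, let $p^\mu(t,\cdot)$ be the marginal density function of the inverse subordinator $E^\mu_t$, and let the family $(\mathcal{T}_t)_{t\ge0}$ be given by $$\mathcal{T}_t\varphi:=\int_0^\infty T_\tau\varphi\,p^\mu(t,\tau)\,d\tau,\qquad\varphi\in X.$$ Let $f:[0,\infty)\to X$ be defined via $f(t):=\mathcal{T}_tf_0$. For each $n\in\mathbb{N}$ define the mappings $f_n:[0,\infty)\to X$ by $$f_n(t):=\int_0^\infty F^n(\tau/n)f_0\,p^\mu(t,\tau)\,d\tau ,$$ where $F^n(\tau/n)=[F(\tau/n)]^n$. Then it holds locally uniformly with respect to $t\ge0$ that $$\|f_n(t)-f(t)\|_X\to0,\qquad n\to\infty.$$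
   Context: Chernoff equivalence. A family $(F(t))_{t\ge0}$ of bounded linear operators on $X$ is called Chernoff equivalent to a strongly continuous semigroup $(T_t)_{t\ge0}$ with generator $(L,\mathrm{Dom}(L))$ if: $F(0)=\mathrm{Id}$; $\|F(t)\|\le e^{wt}$ for some $w\in\mathbb{R}$ and all $t\ge0$; and the limit $L\varphi=\lim_{t\to0}\frac{F(t)\varphi-\varphi}{t}$ exists for all $\varphi\in D$, where $D$ is a dense subspace of $X$ such that $(L,D)$ is closable and its closure is the generator $(L,\mathrm{Dom}(L))$ of $(T_t)_{t\ge0}$. By the Chernoff theorem this implies $T_t\varphi=\lim_{n\to\infty}[F(t/n)]^n\varphi$ for all $\varphi\in X$, locally uniformly with respect to $t\ge0$. Measurability. The strong Borel measurability condition, i.e. Borel measurability of all the mappings $t\mapsto\|F(t)\varphi\|_X$, $\varphi\in X$, is fulfilled if, e.g., the family $(F(t))_{t\ge0}$ is strongly continuous. If a family of contractions $(F(t))_{t\ge0}$ on $X$ satisfies this condition, then the Bochner integrals defining $f_n$ are well-defined and finite. A contraction is a linear operator of norm at most $1$. Inverse subordinator. Let $f^\mu(s):=\int_0^1s^\beta\mu(d\beta)$, $s>0$ (a Bernstein function), and let $(D^\mu_t)_{t\ge0}$ be the subordinator (one-dimensional Lévy process with almost surely non-decreasing paths) corresponding to $f^\mu$, i.e. $\mathbb{E}[e^{-sD^\mu_t}]=e^{-tf^\mu(s)}$. Put $E^\mu_t:=\inf\{\tau\ge0:D^\mu_\tau>t\}$. The process $(E^\mu_t)_{t\ge0}$ possesses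 a marginal density function $p^\mu(t,x)$, i.e. $\mathbb{P}(E^\mu_t\in B)=\int_Bp^\mu(t,x)\,dx$ for all Borel $B\subset\mathbb{R}$, with $p^\mu(t,x)=0$ for all $x<0$. For $t=0$, $p^\mu(0,\tau)\,d\tau$ is read as the law of $E^\mu_0=0$, i.e. the Dirac measure $\delta_0$.
   Formalization: The Bochner integrals defining f_n(t) are assumed to exist for all n≥1 and t≥0; Borel measurability of the norms ‖F(t)φ‖ alone does not ensure this (e.g. X=ℝ, F(t)=±Id with a non-measurable sign for t>1). *)

theory Defs
  imports "HOL-Probability.Probability"
begin

section \<open>Bochner integral in an arbitrary Banach space\<close>

text \<open>
  The library's \<open>has_bochner_integral\<close> is restricted to second countable (that is, separable)
  spaces. The definition below repeats it for an arbitrary Banach space; Borel measurability of the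
  integrand is replaced by strong measurability (almost everywhere limit of simple functions).
  Lemma \<open>has_bochner_eq_has_bochner_integral\<close> shows that both agree for Borel functions
  with values in a separable space.
\<close>

definition strongly_measurable :: "'w measure \<Rightarrow> ('w \<Rightarrow> 'a::real_normed_vector) \<Rightarrow> bool" where
  "strongly_measurable M g \<longleftrightarrow>
     (\<exists>u. (\<forall>i. simple_function M (u i)) \<and> (AE x in M. (\<lambda>i. u i x) \<longlonglongrightarrow> g x))"

definition has_bochner :: "'w measure \<Rightarrow> ('w \<Rightarrow> 'a::real_normed_vector) \<Rightarrow> 'a \<Rightarrow> bool" where
  "has_bochner M g y \<longleftrightarrow> strongly_measurable M g \<and>
     (\<exists>s. (\<forall>i. Bochner_Integration.simple_bochner_integrable M (s i)) \<and>
          (\<lambda>i. \<integral>\<^sup>+x. norm (g x - s i x) \<partial>M) \<longlonglongrightarrow> 0 \<and>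
          (\<lambda>i. Bochner_Integration.simple_bochner_integral M (s i)) \<longlonglongrightarrow> y)"

definition bochner_integrable :: "'w measure \<Rightarrow> ('w \<Rightarrow> 'a::real_normed_vector) \<Rightarrow> bool" where
  "bochner_integrable M g \<longleftrightarrow> (\<exists>y. has_bochner M g y)"

text \<open>Meaningful only for \<open>bochner_integrable\<close> integrands; see \<open>has_bochner_unique\<close>.\<close>

definition bochner_integral :: "'w measure \<Rightarrow> ('w \<Rightarrow> 'a::real_normed_vector) \<Rightarrow> 'a" where
  "bochner_integral M g = (THE y. has_bochner M g y)"

lemma has_bochner_eq_has_bochner_integral:
  fixes g :: "'w \<Rightarrow> 'a::{real_normed_vector, second_countable_topology}"
  assumes "g \<in> borel_measurable M"
  shows "has_bochner M g y \<longleftrightarrow> has_bochner_integral M g y"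
proof -
  obtain u where "\<And>i. simple_function M (u i)" "\<And>x. x \<in> space M \<Longrightarrow> (\<lambda>i. u i x) \<longlonglongrightarrow> g x"
    using borel_measurable_implies_sequence_metric[OF assms, of undefined] by blast
  then have "strongly_measurable M g"
    unfolding strongly_measurable_def by (intro exI[of _ u]) auto
  then show ?thesis
    using assms by (auto simp: has_bochner_def has_bochner_integral.simps)
qed

lemma strongly_measurable_norm_diff:
  assumes "strongly_measurable M g" "simple_function M s"
  obtains h :: "_ \<Rightarrow> ennreal"
    where "h \<in> borel_measurable M" "AE x in M. ennreal (norm (g x - s x)) = h x"
proof -
  obtain u where u: "\<And>i. simple_function M (u i)" and lim: "AE x in M. (\<lambda>i. u i x) \<longlonglongrightarrow> g x"
    using assms(1) unfolding strongly_measurable_def by blast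
  let ?h = "\<lambda>x. limsup (\<lambda>i. ennreal (norm (u i x - s x)))"
  have "simple_function M (\<lambda>x. ennreal (norm (u i x - s x)))" for i
    by (rule simple_function_compose2[OF u assms(2), where h = "\<lambda>a b. ennreal (norm (a - b))"])
  then have "(\<lambda>x. ennreal (norm (u i x - s x))) \<in> borel_measurable M" for i
    by (rule borel_measurable_simple_function)
  then have 1: "?h \<in> borel_measurable M"
    by (rule borel_measurable_limsup)
  have 2: "AE x in M. ennreal (norm (g x - s x)) = ?h x"
    using lim
  proof eventually_elim
    case (elim x)
    then have "(\<lambda>i. ennreal (norm (u i x - s x))) \<longlonglongrightarrow> ennreal (norm (g x - s x))"
      by (intro tendsto_intros)
    from lim_imp_Limsup[OF sequentially_bot this] show ?case by (rule sym)
  qed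
  show ?thesis using that[OF 1 2] .
qed

lemma has_bochner_unique:
  assumes "has_bochner M g y" "has_bochner M g z"
  shows "y = z"
proof -
  obtain s where s: "\<And>i. Bochner_Integration.simple_bochner_integrable M (s i)"
      "(\<lambda>i. \<integral>\<^sup>+x. norm (g x - s i x) \<partial>M) \<longlonglongrightarrow> 0"
      "(\<lambda>i. Bochner_Integration.simple_bochner_integral M (s i)) \<longlonglongrightarrow> y"
    and sm: "strongly_measurable M g"
    using assms(1) unfolding has_bochner_def by blast
  obtain t where t: "\<And>i. Bochner_Integration.simple_bochner_integrable M (t i)"
      "(\<lambda>i. \<integral>\<^sup>+x. norm (g x - t i x) \<partial>M) \<longlonglongrightarrow> 0"
      "(\<lambda>i. Bochner_Integration.simple_bochner_integral M (t i)) \<longlonglongrightarrow> z"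
    using assms(2) unfolding has_bochner_def by blast
  let ?a = "\<lambda>i. \<integral>\<^sup>+x. norm (g x - s i x) \<partial>M" and ?b = "\<lambda>i. \<integral>\<^sup>+x. norm (g x - t i x) \<partial>M"
  let ?d = "\<lambda>i. norm (Bochner_Integration.simple_bochner_integral M (s i) - Bochner_Integration.simple_bochner_integral M (t i))"
  have bound: "ennreal (?d i) \<le> ?a i + ?b i" for i
  proof -
    have sf: "simple_function M (s i)" "simple_function M (t i)"
      using s(1) t(1) by (auto elim: Bochner_Integration.simple_bochner_integrable.cases)
    obtain h where h: "h \<in> borel_measurable M" "AE x in M. ennreal (norm (g x - s i x)) = h x"
      using strongly_measurable_norm_diff[OF sm sf(1)] .
    obtain k where k: "k \<in> borel_measurable M" "AE x in M. ennreal (norm (g x - t i x)) = k x"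
      using strongly_measurable_norm_diff[OF sm sf(2)] .
    have st: "Bochner_Integration.simple_bochner_integrable M (\<lambda>x. s i x - t i x)"
      using s(1) t(1) by (rule simple_bochner_integrable_compose2[of "\<lambda>a b. a - b", rotated 1]) simp
    then have nst: "Bochner_Integration.simple_bochner_integrable M (\<lambda>x. norm (s i x - t i x))"
      using simple_bochner_integrable_compose2[of "\<lambda>a b. norm a", OF _ st st] by simp
    have "?d i \<le> Bochner_Integration.simple_bochner_integral M (\<lambda>x. norm (s i x - t i x))"
      using simple_bochner_integral_norm_bound[OF st] simple_bochner_integral_diff[OF s(1) t(1)]
      by simp
    then have "ennreal (?d i) \<le> ennreal (Bochner_Integration.simple_bochner_integral M (\<lambda>x. norm (s i x - t i x)))"
      by (rule ennreal_leI)
    also have "\<dots> = (\<integral>\<^sup>+x. norm (s i x - t i x) \<partial>M)"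
      by (rule simple_bochner_integral_eq_nn_integral[OF nst]) simp
    also have "\<dots> \<le> (\<integral>\<^sup>+x. h x + k x \<partial>M)"
    proof (rule nn_integral_mono_AE)
      show "AE x in M. ennreal (norm (s i x - t i x)) \<le> h x + k x"
        using h(2) k(2)
      proof eventually_elim
        case (elim x)
        have "norm (s i x - t i x) \<le> norm (g x - s i x) + norm (g x - t i x)"
          using norm_triangle_ineq4[of "g x - t i x" "g x - s i x"] by simp
        then have "ennreal (norm (s i x - t i x)) \<le> ennreal (norm (g x - s i x)) + ennreal (norm (g x - t i x))"
          by (simp add: ennreal_leI flip: ennreal_plus)
        then show ?case
          unfolding elim .
      qed
    qed
    also have "\<dots> = (\<integral>\<^sup>+x. h x \<partial>M) + (\<integral>\<^sup>+x. k x \<partial>M)"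
      using h(1) k(1) by (rule nn_integral_add)
    also have "(\<integral>\<^sup>+x. h x \<partial>M) = ?a i"
      using h(2) by (intro nn_integral_cong_AE) auto
    also have "(\<integral>\<^sup>+x. k x \<partial>M) = ?b i"
      using k(2) by (intro nn_integral_cong_AE) auto
    finally show ?thesis .
  qed
  have "(\<lambda>i. ?a i + ?b i) \<longlonglongrightarrow> 0"
    using tendsto_add[OF s(2) t(2)] by (simp only: add_0)
  then have "(\<lambda>i. ennreal (?d i)) \<longlonglongrightarrow> 0"
    by (rule tendsto_sandwich[OF always_eventually always_eventually tendsto_const, rotated 2])
       (intro allI zero_le bound)+
  then have "(\<lambda>i. ennreal (?d i)) \<longlonglongrightarrow> ennreal 0"
    by (simp only: ennreal_0)
  then have "?d \<longlonglongrightarrow> 0"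
    by (rule tendsto_ennrealD) simp_all
  moreover have "?d \<longlonglongrightarrow> norm (y - z)"
    using s(3) t(3) by (intro tendsto_intros)
  ultimately have "0 = norm (y - z)"
    by (rule LIMSEQ_unique)
  then show ?thesis by simp
qed

lemma bochner_integral_eq: "has_bochner M g y \<Longrightarrow> bochner_integral M g = y"
  unfolding bochner_integral_def by (blast intro: has_bochner_unique)

section \<open>Semigroups, generators and Chernoff equivalence\<close>

text \<open>
  Families of operators indexed by $t \ge 0$ are functions on the reals; their values at negative
  arguments are never used. An unbounded operator is a function together with its domain.
\<close>

definition contraction :: "('a::real_normed_vector \<Rightarrow> 'a) \<Rightarrow> bool" where
  "contraction A \<longleftrightarrow> bounded_linear A \<and> onorm A \<le> 1"

definition strongly_continuous_semigroup :: "(real \<Rightarrow> 'a::real_normed_vector \<Rightarrow> 'a) \<Rightarrow> bool" where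
  "strongly_continuous_semigroup T \<longleftrightarrow>
     (\<forall>t\<ge>0. bounded_linear (T t)) \<and>
     T 0 = id \<and>
     (\<forall>s\<ge>0. \<forall>t\<ge>0. T (s + t) = T s \<circ> T t) \<and>
     (\<forall>\<phi>. continuous_on {0..} (\<lambda>t. T t \<phi>))"

definition is_generator ::
  "(real \<Rightarrow> 'a::real_normed_vector \<Rightarrow> 'a) \<Rightarrow> ('a \<Rightarrow> 'a) \<Rightarrow> 'a set \<Rightarrow> bool" where
  "is_generator T L DomL \<longleftrightarrow>
     DomL = {\<phi>. \<exists>\<psi>. ((\<lambda>t. (T t \<phi> - \<phi>) /\<^sub>R t) \<longlongrightarrow> \<psi>) (at_right 0)} \<and>
     (\<forall>\<phi>\<in>DomL. ((\<lambda>t. (T t \<phi> - \<phi>) /\<^sub>R t) \<longlongrightarrow> L \<phi>) (at_right 0))"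

definition op_graph :: "('a \<Rightarrow> 'a) \<Rightarrow> 'a set \<Rightarrow> ('a \<times> 'a) set" where
  "op_graph A D = (\<lambda>\<phi>. (\<phi>, A \<phi>)) ` D"

definition closable_op :: "('a::real_normed_vector \<Rightarrow> 'a) \<Rightarrow> 'a set \<Rightarrow> bool" where
  "closable_op A D \<longleftrightarrow> (\<exists>B DB. closure (op_graph A D) = op_graph B DB)"

definition chernoff_equivalent ::
  "(real \<Rightarrow> 'a::real_normed_vector \<Rightarrow> 'a) \<Rightarrow> (real \<Rightarrow> 'a \<Rightarrow> 'a) \<Rightarrow> bool" where
  "chernoff_equivalent F T \<longleftrightarrow>
     (\<forall>t\<ge>0. bounded_linear (F t)) \<and>
     F 0 = id \<and>
     (\<exists>w. \<forall>t\<ge>0. onorm (F t) \<le> exp (w * t)) \<and>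
     (\<exists>L DomL D. is_generator T L DomL \<and>
        subspace D \<and> closure D = UNIV \<and> D \<subseteq> DomL \<and>
        (\<forall>\<phi>\<in>D. ((\<lambda>t. (F t \<phi> - \<phi>) /\<^sub>R t) \<longlongrightarrow> L \<phi>) (at_right 0)) \<and>
        closable_op L D \<and>
        closure (op_graph L D) = op_graph L DomL)"

section \<open>Inverse subordinators\<close>

definition measure_support :: "'a::topological_space measure \<Rightarrow> 'a set" where
  "measure_support \<mu> = {x. \<forall>U. open U \<and> x \<in> U \<longrightarrow> emeasure \<mu> U > 0}"

definition bernstein_fn :: "real measure \<Rightarrow> real \<Rightarrow> real" where
  "bernstein_fn \<mu> s = (LINT \<beta>:{0..1}|\<mu>. s powr \<beta>)"

text \<open>
  Levy processes are understood via stochastic continuity. Regularity of the paths (e.g. right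
  continuity with left limits) is not required, so that conventions including it are covered.
\<close>

definition levy_process :: "'w measure \<Rightarrow> (real \<Rightarrow> 'w \<Rightarrow> real) \<Rightarrow> bool" where
  "levy_process M D \<longleftrightarrow>
     prob_space M \<and>
     (\<forall>t\<ge>0. D t \<in> borel_measurable M) \<and>
     (AE \<omega> in M. D 0 \<omega> = 0) \<and>
     (\<forall>(t :: nat \<Rightarrow> real) n. 0 \<le> t 0 \<and> mono t \<longrightarrow>
        prob_space.indep_vars M (\<lambda>_. borel) (\<lambda>i \<omega>. D (t (Suc i)) \<omega> - D (t i) \<omega>) {..<n}) \<and>
     (\<forall>s\<ge>0. \<forall>h\<ge>0. distr M borel (\<lambda>\<omega>. D (s + h) \<omega> - D s \<omega>) = distr M borel (D h)) \<and>
     (\<forall>t\<ge>0. \<forall>\<epsilon>>0.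
        ((\<lambda>s. measure M {\<omega>\<in>space M. \<bar>D s \<omega> - D t \<omega>\<bar> > \<epsilon>}) \<longlongrightarrow> 0) (at t within {0..}))"

definition subordinator :: "'w measure \<Rightarrow> (real \<Rightarrow> 'w \<Rightarrow> real) \<Rightarrow> bool" where
  "subordinator M D \<longleftrightarrow> levy_process M D \<and> (AE \<omega> in M. mono_on {0..} (\<lambda>t. D t \<omega>))"

definition corresponds_to :: "'w measure \<Rightarrow> (real \<Rightarrow> 'w \<Rightarrow> real) \<Rightarrow> (real \<Rightarrow> real) \<Rightarrow> bool" where
  "corresponds_to M D \<Phi> \<longleftrightarrow>
     (\<forall>s>0. \<forall>t\<ge>0. prob_space.expectation M (\<lambda>\<omega>. exp (- s * D t \<omega>)) = exp (- t * \<Phi> s))"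

text \<open>
  Paths that never exceed $t$ (where the infimum of the empty set is an arbitrary real) form a
  null set as soon as the Bernstein function is positive.
\<close>

definition inverse_process :: "(real \<Rightarrow> 'w \<Rightarrow> real) \<Rightarrow> real \<Rightarrow> 'w \<Rightarrow> real" where
  "inverse_process D t \<omega> = Inf {\<tau>. 0 \<le> \<tau> \<and> D \<tau> \<omega> > t}"

text \<open>The density exists only for $t > 0$; the law at time $0$ is the Dirac measure at $0$.\<close>

definition marginal_density ::
  "'w measure \<Rightarrow> (real \<Rightarrow> 'w \<Rightarrow> real) \<Rightarrow> (real \<Rightarrow> real \<Rightarrow> real) \<Rightarrow> bool" where
  "marginal_density M E p \<longleftrightarrow>
     (\<forall>t>0. (\<forall>x. 0 \<le> p t x) \<and> (\<forall>x<0. p t x = 0) \<and>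
        distributed M lborel (E t) (\<lambda>x. ennreal (p t x)))"

text \<open>The measure $p(t,\tau)\,d\tau$ on $[0,\infty)$, which is the Dirac measure at $0$ for $t = 0$.\<close>

definition density_measure :: "(real \<Rightarrow> real \<Rightarrow> real) \<Rightarrow> real \<Rightarrow> real measure" where
  "density_measure p t =
     (if t = 0 then return (restrict_space borel {0..}) 0
      else density (restrict_space lborel {0..}) (\<lambda>\<tau>. ennreal (p t \<tau>)))"

definition subordinate_family ::
  "(real \<Rightarrow> 'a::real_normed_vector \<Rightarrow> 'a) \<Rightarrow> (real \<Rightarrow> real \<Rightarrow> real) \<Rightarrow> real \<Rightarrow> 'a \<Rightarrow> 'a" where
  "subordinate_family T p t \<phi> = bochner_integral (density_measure p t) (\<lambda>\<tau>. T \<tau> \<phi>)"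

end

theory Submission
  imports Defs
begin

text \<open>
  Chernoff's theorem on the domain of the generator is proved with the discrete resolvents
  $R_h = (1 - A_h)^{-1}$ of $A_h = (F(h) - 1)/h$, which are contractions. Since $D$ is a core,
  $R_h (\varphi - L\varphi) \to \varphi$ for all $\varphi$ in $\mathrm{Dom}(L)$, and by
  equicontinuity this is uniform along compact pieces of orbits of $T$. If moreover
  $L\varphi \in \mathrm{Dom}(L)$, then with $\psi = \varphi - L\varphi$ the sequence
  $u_k = R_h T_{kh} \psi$ is close to $T_{kh}\varphi$ and satisfies
  $\|F(h) u_k - u_{k+1}\| = h\, o(1)$ uniformly for bounded $kh$, so that
  $\|F(h)^n u_0 - u_n\| = nh\, o(1)$ by telescoping. The averages
  $\frac1h \int_0^h T_t \psi\,dt$ show that such $\varphi$ approximate every element of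
  $\mathrm{Dom}(L)$.

  The theorem follows by splitting the integrals at a large $r$: for $\tau \le r$ the integrands
  converge uniformly, and the mass beyond $r$ is at most
  $P(E_t > r) \le P(D_r \le t) \le e^{t - r f^\mu(1)}$, where
  $f^\mu(1) = \mu([0,1]) > 0$.
\<close>

section \<open>Contractions and their discrete resolvents\<close>

lemma contraction_norm_le: "contraction A \<Longrightarrow> norm (A x) \<le> norm x"
  unfolding contraction_def
  by (metis landau_o.R_mult_right_mono linorder_not_le mult_1 mult_right_mono norm_ge_zero onorm order_trans)

lemma contraction_linear: "contraction A \<Longrightarrow> linear A"
  by (simp add: contraction_def bounded_linear.linear)

lemma contractionI:
  assumes "linear A" "\<And>x. norm (A x) \<le> norm x"
  shows "contraction A"
  unfolding contraction_def
proof
  show bl: "bounded_linear A"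
    using assms by (intro linear_conv_bounded_linear[THEN iffD1] bounded_linear_intro[of A 1])
      (auto simp: linear_add linear_scale)
  show "onorm A \<le> 1"
    by (rule onorm_bound) (use assms(2) in auto)
qed

text \<open>The equation is \<open>u - (A u - u) /\<^sub>R h = v\<close> multiplied by
  \<open>h\<close>. Since \<open>A\<close> is contractive, one copy of \<open>norm u\<close> cancels
  on both sides. This is the dissipativity of \<open>(A - 1) / h\<close>.\<close>

lemma resolvent_norm_le:
  assumes "contraction A" "h > 0" "(1 + h) *\<^sub>R u = h *\<^sub>R v + A u"
  shows "norm u \<le> norm v"
proof -
  have "(1 + h) * norm u = norm (h *\<^sub>R v + A u)"
    using assms(2) by (metis (no_types, lifting) abs_of_pos add_pos_pos assms(3) norm_scaleR zero_less_one)
  also have "\<dots> \<le> h * norm v + norm u"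
    using norm_triangle_ineq[of "h *\<^sub>R v" "A u"] contraction_norm_le[OF assms(1), of u] assms(2)
    by simp
  finally have "h * norm u \<le> h * norm v" by (simp add: algebra_simps)
  then show ?thesis using assms(2) by simp
qed

text \<open>For each \<open>v\<close> the equation is a fixed point problem with Lipschitz constant
  \<open>1 / (1 + h) < 1\<close>. Uniqueness of the solution, from the norm bound applied to
  differences, yields linearity of \<open>R\<close>.\<close>

lemma resolvent_exists:
  fixes A :: "'a::banach \<Rightarrow> 'a"
  assumes A: "contraction A" and h: "h > 0"
  shows "\<exists>R. contraction R \<and> (\<forall>v. (1 + h) *\<^sub>R R v = h *\<^sub>R v + A (R v))"
proof -
  have lin: "linear A" by (rule contraction_linear[OF A])
  have "\<exists>u. (1 + h) *\<^sub>R u = h *\<^sub>R v + A u" for v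
  proof -
    let ?g = "\<lambda>u. (h *\<^sub>R v + A u) /\<^sub>R (1 + h)"
    have "\<exists>!u. ?g u = u"
    proof (rule banach_fix_type, safe)
      show "0 \<le> 1 / (1 + h)" "1 / (1 + h) < 1" using h by auto
      fix x y
      have "?g x - ?g y = A (x - y) /\<^sub>R (1 + h)"
        by (simp only: linear_diff[OF lin] scaleR_diff_right[symmetric] add_diff_cancel_left)
      then have "dist (?g x) (?g y) = norm (A (x - y)) / (1 + h)"
        using h by (simp add: dist_norm divide_inverse_commute)
      also have "\<dots> \<le> 1 / (1 + h) * dist x y"
        using contraction_norm_le[OF A, of "x - y"] h by (simp add: dist_norm divide_right_mono)
      finally show "dist (?g x) (?g y) \<le> 1 / (1 + h) * dist x y" .
    qed
    then obtain u where "?g u = u" by auto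
    then have "(1 + h) *\<^sub>R u = (1 + h) *\<^sub>R ?g u" by simp
    also have "\<dots> = h *\<^sub>R v + A u" using h by simp
    finally show ?thesis by blast
  qed
  then obtain R where R: "\<And>v. (1 + h) *\<^sub>R R v = h *\<^sub>R v + A (R v)" by metis
  have eq: "u = R v" if "(1 + h) *\<^sub>R u = h *\<^sub>R v + A u" for u v
  proof -
    have "(1 + h) *\<^sub>R (u - R v) = h *\<^sub>R 0 + A (u - R v)"
      using that R[of v] by (simp add: scaleR_diff_right linear_diff[OF lin])
    from resolvent_norm_le[OF A h this] show ?thesis by simp
  qed
  have "linear R"
  proof
    fix x y
    have "(1 + h) *\<^sub>R (R x + R y) = h *\<^sub>R (x + y) + A (R x + R y)"
      unfolding scaleR_add_right[of "1+h"] R by (simp add: linear_add[OF lin] scaleR_add_right)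
    then show "R (x + y) = R x + R y" by (rule eq[symmetric])
  next
    fix c x
    have "(1 + h) *\<^sub>R (c *\<^sub>R R x) = h *\<^sub>R (c *\<^sub>R x) + A (c *\<^sub>R R x)"
      unfolding scaleR_left_commute[of "1+h"] R by (simp add: linear_scale[OF lin] scaleR_add_right)
    then show "R (c *\<^sub>R x) = c *\<^sub>R R x" by (rule eq[symmetric])
  qed
  then have "contraction R"
    by (rule contractionI) (rule resolvent_norm_le[OF A h R])
  with R show ?thesis by blast
qed

text \<open>Subtracting the equation that \<open>\<phi>\<close> satisfies trivially shows that
  \<open>u - \<phi>\<close> is the resolvent of
  \<open>v - \<phi> + (A \<phi> - \<phi>) /\<^sub>R h\<close>, and the resolvent is
  contractive.\<close>

lemma resolvent_error:
  assumes A: "contraction A" and h: "h > 0" and R: "(1 + h) *\<^sub>R u = h *\<^sub>R v + A u"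
  shows "norm (u - \<phi>) \<le> norm (v - \<phi> + (A \<phi> - \<phi>) /\<^sub>R h)"
proof (rule resolvent_norm_le[OF A h])
  have "(1 + h) *\<^sub>R (u - \<phi>) = h *\<^sub>R (v - \<phi>) + (A \<phi> - \<phi>) + A (u - \<phi>)"
    unfolding scaleR_diff_right[of "1+h"] R
    by (simp add: linear_diff[OF contraction_linear[OF A]] algebra_simps)
  then show "(1 + h) *\<^sub>R (u - \<phi>) = h *\<^sub>R (v - \<phi> + (A \<phi> - \<phi>) /\<^sub>R h) + A (u - \<phi>)"
    using h by (simp add: scaleR_add_right)
qed

text \<open>Each local error \<open>A (u k) - u (Suc k)\<close> is carried on by powers of
  \<open>A\<close>, which do not enlarge it, so the errors merely add up.\<close>

lemma contraction_telescope:
  assumes A: "contraction A" and e: "\<And>k. k < n \<Longrightarrow> norm (A (u k) - u (Suc k)) \<le> e"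
  shows "norm ((A ^^ n) (u 0) - u n) \<le> real n * e"
  using e
proof (induction n)
  case (Suc n)
  have eq: "(A ^^ Suc n) (u 0) - u (Suc n) = A ((A ^^ n) (u 0) - u n) + (A (u n) - u (Suc n))"
    by (simp add: linear_diff[OF contraction_linear[OF A]])
  have "norm ((A ^^ Suc n) (u 0) - u (Suc n))
      \<le> norm ((A ^^ n) (u 0) - u n) + norm (A (u n) - u (Suc n))"
    using norm_triangle_ineq[of "A ((A ^^ n) (u 0) - u n)" "A (u n) - u (Suc n)"]
      contraction_norm_le[OF A, of "(A ^^ n) (u 0) - u n"] unfolding eq by linarith
  also have "\<dots> \<le> real n * e + e"
    using Suc by (intro add_mono) auto
  finally show ?case by (simp add: algebra_simps)
qed simp

lemma contraction_funpow: "contraction A \<Longrightarrow> contraction (A ^^ n)"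
proof (induction n)
  case 0
  show ?case by (rule contractionI) (auto simp: linear_iff)
next
  case (Suc n)
  then have "linear (A \<circ> (A ^^ n))"
    by (intro linear_compose contraction_linear) auto
  moreover have "norm (A ((A ^^ n) x)) \<le> norm x" for x
    using Suc contraction_norm_le order_trans by blast
  ultimately show ?case by (intro contractionI) (auto simp: o_def)
qed

section \<open>Uniform smallness on compact sets\<close>

lemma equicontinuous_imp_uniformly_small:
  fixes g :: "'h \<Rightarrow> 'b::topological_space \<Rightarrow> 'a::real_normed_vector" and m :: "'b \<Rightarrow> 'c::metric_space"
  assumes S: "compact S" and m: "continuous_on S m"
    and eq: "\<forall>\<^sub>F h in \<F>. \<forall>s\<in>S. \<forall>s'\<in>S. norm (g h s - g h s') \<le> C * dist (m s) (m s')"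
    and pt: "\<And>s. s \<in> S \<Longrightarrow> ((\<lambda>h. g h s) \<longlongrightarrow> 0) \<F>" and e: "e > 0"
  shows "\<forall>\<^sub>F h in \<F>. \<forall>s\<in>S. norm (g h s) < e"
proof -
  \<comment> \<open>The radius satisfies \<open>(\<bar>C\<bar> + 1) * d = e / 2\<close>; adding 1
    keeps the denominator positive.\<close>
  define d where "d = e / (2 * (\<bar>C\<bar> + 1))"
  have d: "d > 0" using e by (simp add: d_def zero_less_divide_iff add_nonneg_pos)
  have "compact (m ` S)" using m S by (rule compact_continuous_image)
  then obtain k where k: "finite k" "k \<subseteq> m ` S" "m ` S \<subseteq> (\<Union>x\<in>k. ball x d)"
    by (rule compactE_image[of "m ` S" "m ` S" "\<lambda>x. ball x d"]) (use d in auto)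
  obtain k' where k': "finite k'" "k' \<subseteq> S" "k = m ` k'"
    using finite_subset_image[OF k(1,2)] by blast
  have "\<forall>\<^sub>F h in \<F>. \<forall>s\<in>k'. norm (g h s) < e / 2"
    using k'(1)
  proof (rule eventually_ball_finite, intro ballI)
    fix s assume "s \<in> k'"
    then have "((\<lambda>h. g h s) \<longlongrightarrow> 0) \<F>" using pt k' by auto
    from tendstoD[OF this, of "e / 2"] e show "\<forall>\<^sub>F h in \<F>. norm (g h s) < e / 2" by simp
  qed
  with eq show ?thesis
  proof eventually_elim
    case (elim h)
    show ?case
    proof
      fix s assume s: "s \<in> S"
      then obtain s' where s': "s' \<in> k'" "dist (m s') (m s) < d"
        using k(3) k'(3) by auto
      have "norm (g h s) \<le> norm (g h s - g h s') + norm (g h s')"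
        by (metis add.commute diff_add_cancel norm_triangle_ineq)
      moreover have "norm (g h s - g h s') \<le> C * dist (m s) (m s')"
        using elim(1) s s' k' by blast
      moreover have "C * dist (m s) (m s') \<le> (\<bar>C\<bar> + 1) * d"
        using s' d by (intro mult_mono) (auto simp: dist_commute)
      moreover have "(\<bar>C\<bar> + 1) * d = e / 2"
        by (simp add: d_def field_simps)
      moreover have "norm (g h s') < e / 2" using elim(2) s' by blast
      ultimately show "norm (g h s) < e" by linarith
    qed
  qed
qed

section \<open>The Chernoff approximation\<close>

locale contraction_semigroup =
  fixes T :: "real \<Rightarrow> 'a::banach \<Rightarrow> 'a" and L :: "'a \<Rightarrow> 'a" and DomL :: "'a set"
  assumes semigroup: "strongly_continuous_semigroup T"
    and T_contraction: "\<And>t. t \<ge> 0 \<Longrightarrow> contraction (T t)"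
    and generator: "is_generator T L DomL"
begin

lemma T_0: "T 0 x = x"
  using semigroup by (simp add: strongly_continuous_semigroup_def)

lemma T_add: "s \<ge> 0 \<Longrightarrow> t \<ge> 0 \<Longrightarrow> T (s + t) x = T s (T t x)"
  using semigroup by (simp add: strongly_continuous_semigroup_def)

lemma continuous_on_T: "S \<subseteq> {0..} \<Longrightarrow> continuous_on S (\<lambda>t. T t x)"
  using semigroup unfolding strongly_continuous_semigroup_def by (metis continuous_on_subset)

lemma T_diff: "t \<ge> 0 \<Longrightarrow> T t (x - y) = T t x - T t y"
  by (simp add: T_contraction contraction_linear linear_diff)

lemma T_scaleR: "t \<ge> 0 \<Longrightarrow> T t (c *\<^sub>R x) = c *\<^sub>R T t x"
  by (simp add: T_contraction contraction_linear linear_scale)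

lemma T_bounded_linear: "t \<ge> 0 \<Longrightarrow> bounded_linear (T t)"
  using T_contraction contraction_def by blast

lemma T_norm_le: "t \<ge> 0 \<Longrightarrow> norm (T t x) \<le> norm x"
  by (simp add: T_contraction contraction_norm_le)

lemma generator_tendsto:
  "\<phi> \<in> DomL \<Longrightarrow> ((\<lambda>t. (T t \<phi> - \<phi>) /\<^sub>R t) \<longlongrightarrow> L \<phi>) (at_right 0)"
  using generator by (simp add: is_generator_def)

lemma generatorI:
  assumes "((\<lambda>t. (T t \<phi> - \<phi>) /\<^sub>R t) \<longlongrightarrow> \<psi>) (at_right 0)"
  shows "\<phi> \<in> DomL" "L \<phi> = \<psi>"
proof -
  show "\<phi> \<in> DomL" using assms generator unfolding is_generator_def by blast
  from tendsto_unique[OF _ generator_tendsto[OF this] assms] show "L \<phi> = \<psi>" by simp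
qed

lemma generator_diff:
  assumes "\<phi> \<in> DomL" "\<eta> \<in> DomL"
  shows "\<phi> - \<eta> \<in> DomL" "L (\<phi> - \<eta>) = L \<phi> - L \<eta>"
proof -
  have "((\<lambda>t. (T t \<phi> - \<phi>) /\<^sub>R t - (T t \<eta> - \<eta>) /\<^sub>R t) \<longlongrightarrow> L \<phi> - L \<eta>) (at_right 0)"
    using assms by (intro tendsto_diff generator_tendsto)
  moreover have "\<forall>\<^sub>F t in at_right 0. (T t \<phi> - \<phi>) /\<^sub>R t - (T t \<eta> - \<eta>) /\<^sub>R t
      = (T t (\<phi> - \<eta>) - (\<phi> - \<eta>)) /\<^sub>R t"
    using eventually_at_right_less[of "0::real"]
    by eventually_elim (simp add: T_diff algebra_simps)
  ultimately have "((\<lambda>t. (T t (\<phi> - \<eta>) - (\<phi> - \<eta>)) /\<^sub>R t) \<longlongrightarrow> L \<phi> - L \<eta>) (at_right 0)"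
    by (rule Lim_transform_eventually)
  then show "\<phi> - \<eta> \<in> DomL" "L (\<phi> - \<eta>) = L \<phi> - L \<eta>" by (auto dest: generatorI)
qed

lemma generator_scaleR:
  assumes "\<phi> \<in> DomL"
  shows "c *\<^sub>R \<phi> \<in> DomL" "L (c *\<^sub>R \<phi>) = c *\<^sub>R L \<phi>"
proof -
  have "((\<lambda>t. c *\<^sub>R ((T t \<phi> - \<phi>) /\<^sub>R t)) \<longlongrightarrow> c *\<^sub>R L \<phi>) (at_right 0)"
    using assms by (intro tendsto_scaleR tendsto_const generator_tendsto)
  moreover have "\<forall>\<^sub>F t in at_right 0. c *\<^sub>R ((T t \<phi> - \<phi>) /\<^sub>R t)
      = (T t (c *\<^sub>R \<phi>) - c *\<^sub>R \<phi>) /\<^sub>R t"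
    using eventually_at_right_less[of "0::real"]
    by eventually_elim (simp add: T_scaleR algebra_simps)
  ultimately have "((\<lambda>t. (T t (c *\<^sub>R \<phi>) - c *\<^sub>R \<phi>) /\<^sub>R t) \<longlongrightarrow> c *\<^sub>R L \<phi>) (at_right 0)"
    by (rule Lim_transform_eventually)
  then show "c *\<^sub>R \<phi> \<in> DomL" "L (c *\<^sub>R \<phi>) = c *\<^sub>R L \<phi>" by (auto dest: generatorI)
qed

text \<open>The bounded operator \<open>T s\<close> commutes with the difference quotients of
  \<open>T\<close> at 0 and passes to their limit.\<close>

lemma generator_T:
  assumes "\<phi> \<in> DomL" "s \<ge> 0"
  shows "T s \<phi> \<in> DomL" "L (T s \<phi>) = T s (L \<phi>)"
proof -
  have "((\<lambda>t. T s ((T t \<phi> - \<phi>) /\<^sub>R t)) \<longlongrightarrow> T s (L \<phi>)) (at_right 0)"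
    using assms by (intro bounded_linear.tendsto[OF T_bounded_linear] generator_tendsto)
  moreover have "\<forall>\<^sub>F t in at_right 0. T s ((T t \<phi> - \<phi>) /\<^sub>R t)
      = (T t (T s \<phi>) - T s \<phi>) /\<^sub>R t"
    using eventually_at_right_less[of "0::real"]
  proof eventually_elim
    case (elim t)
    then show ?case
      using T_add[of s t \<phi>] T_add[of t s \<phi>] assms(2)
      by (simp add: T_scaleR T_diff add.commute)
  qed
  ultimately have "((\<lambda>t. (T t (T s \<phi>) - T s \<phi>) /\<^sub>R t) \<longlongrightarrow> T s (L \<phi>)) (at_right 0)"
    by (rule Lim_transform_eventually)
  then show "T s \<phi> \<in> DomL" "L (T s \<phi>) = T s (L \<phi>)" by (auto dest: generatorI)
qed

section \<open>Integrals of orbits and density of the domain of the squared generator\<close>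

lemma integral_T_right_derivative:
  assumes "a \<ge> 0"
  shows "((\<lambda>h. (integral {0..a + h} (\<lambda>t. T t \<psi>) - integral {0..a} (\<lambda>t. T t \<psi>)) /\<^sub>R h)
    \<longlongrightarrow> T a \<psi>) (at_right 0)"
proof -
  let ?G = "\<lambda>u. integral {0..u} (\<lambda>t. T t \<psi>)"
  \<comment> \<open>The interval extends beyond \<open>a\<close>, so that the derivative can be
    restricted to the right of \<open>a\<close>, also when \<open>a = 0\<close>.\<close>
  have "(?G has_vector_derivative T a \<psi>) (at a within {0..a + 1})"
    using assms by (intro integral_has_vector_derivative continuous_on_T) auto
  then have "(?G has_vector_derivative T a \<psi>) (at a within {a..a + 1})"
    by (rule has_vector_derivative_within_subset) (use assms in auto)
  then have "(?G has_vector_derivative T a \<psi>) (at_right a)"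
    by (simp add: at_within_Icc_at_right)
  then have "((\<lambda>y. norm (?G y - ?G a - (y - a) *\<^sub>R T a \<psi>) / norm (y - a)) \<longlongrightarrow> 0) (at_right a)"
    by (simp add: has_vector_derivative_def has_derivative_iff_norm)
  then have "((\<lambda>h. norm (?G (h + a) - ?G a - h *\<^sub>R T a \<psi>) / \<bar>h\<bar>) \<longlongrightarrow> 0) (at_right 0)"
    by (simp add: filterlim_at_right_to_0[of _ _ a])
  moreover have "\<forall>\<^sub>F h in at_right 0. norm (?G (h + a) - ?G a - h *\<^sub>R T a \<psi>) / \<bar>h\<bar>
      = norm ((?G (a + h) - ?G a) /\<^sub>R h - T a \<psi>)"
    using eventually_at_right_less[of "0::real"]
  proof eventually_elim
    case (elim h)
    then have "(?G (a + h) - ?G a) /\<^sub>R h - T a \<psi> = (?G (h + a) - ?G a - h *\<^sub>R T a \<psi>) /\<^sub>R h"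
      by (simp add: scaleR_diff_right add.commute)
    then show ?case by (simp add: divide_inverse_commute)
  qed
  ultimately have "((\<lambda>h. norm ((?G (a + h) - ?G a) /\<^sub>R h - T a \<psi>)) \<longlongrightarrow> 0) (at_right 0)"
    by (rule Lim_transform_eventually)
  then show ?thesis
    using tendsto_norm_zero_iff LIM_zero_cancel by blast
qed

text \<open>As a bounded linear map, \<open>T h\<close> passes under the integral and turns
  \<open>T t\<close> into \<open>T (t + h)\<close>; a substitution then moves the interval to
  \<open>{h..a + h}\<close>.\<close>

lemma integral_T_shift:
  assumes "a \<ge> 0" "h \<ge> 0"
  shows "T h (integral {0..a} (\<lambda>t. T t \<psi>))
    = integral {0..a + h} (\<lambda>t. T t \<psi>) - integral {0..h} (\<lambda>t. T t \<psi>)"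
proof -
  have int: "(\<lambda>t. T t \<psi>) integrable_on {u..v}" if "u \<ge> 0" for u v
    using that by (intro integrable_continuous_interval continuous_on_T) auto
  have "T h (integral {0..a} (\<lambda>t. T t \<psi>)) = integral {0..a} (\<lambda>t. T h (T t \<psi>))"
    using integral_linear[OF int[of 0 a] T_bounded_linear[OF assms(2)]] by (simp add: o_def)
  also have "\<dots> = integral {0..a} (\<lambda>t. T (t + h) \<psi>)"
    using assms by (intro integral_cong) (metis T_add add.commute atLeastAtMost_iff)
  also have "\<dots> = integral {h..a + h} (\<lambda>t. T t \<psi>)"
  proof -
    have "((\<lambda>t. T t \<psi>) has_integral integral {h..a + h} (\<lambda>t. T t \<psi>)) (cbox h (a + h))"
      using int[of h "a + h"] assms by (simp add: integrable_integral)
    from has_integral_affinity'[OF this, of 1 h] show ?thesis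
      by (simp add: integral_unique)
  qed
  also have "\<dots> = integral {0..a + h} (\<lambda>t. T t \<psi>) - integral {0..h} (\<lambda>t. T t \<psi>)"
    using Henstock_Kurzweil_Integration.integral_combine[of 0 h "a + h" "\<lambda>t. T t \<psi>"] assms int[of 0 "a + h"]
    by (simp add: algebra_simps)
  finally show ?thesis .
qed

text \<open>By the shift formula, the difference quotient at 0 of the orbit of the integral is the
  difference of the right difference quotients of
  \<open>integral {0..u} (\<lambda>t. T t \<psi>)\<close> at \<open>a\<close> and at 0. The vector
  \<open>\<psi>\<close> is arbitrary here.\<close>

lemma generator_integral_T:
  assumes "a \<ge> 0"
  shows "integral {0..a} (\<lambda>t. T t \<psi>) \<in> DomL" "L (integral {0..a} (\<lambda>t. T t \<psi>)) = T a \<psi> - \<psi>"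
proof -
  let ?G = "\<lambda>u. integral {0..u} (\<lambda>t. T t \<psi>)"
  have "((\<lambda>h. (?G (a + h) - ?G a) /\<^sub>R h - (?G (0 + h) - ?G 0) /\<^sub>R h) \<longlongrightarrow> T a \<psi> - T 0 \<psi>) (at_right 0)"
    using assms by (intro tendsto_diff integral_T_right_derivative) auto
  moreover have "\<forall>\<^sub>F h in at_right 0. (?G (a + h) - ?G a) /\<^sub>R h - (?G (0 + h) - ?G 0) /\<^sub>R h
      = (T h (?G a) - ?G a) /\<^sub>R h"
    using eventually_at_right_less[of "0::real"]
    by eventually_elim (simp add: integral_T_shift assms flip: scaleR_diff_right)
  ultimately have "((\<lambda>h. (T h (?G a) - ?G a) /\<^sub>R h) \<longlongrightarrow> T a \<psi> - T 0 \<psi>) (at_right 0)"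
    by (rule Lim_transform_eventually)
  then show "?G a \<in> DomL" "L (?G a) = T a \<psi> - \<psi>" by (auto dest: generatorI simp: T_0)
qed

text \<open>The averages of the orbit over \<open>{0..h}\<close> tend to \<open>\<psi>\<close>, and
  \<open>L\<close> maps such an average to \<open>(T h \<psi> - \<psi>) /\<^sub>R h\<close>, which
  inherits membership in \<open>DomL\<close> from \<open>\<psi>\<close>.\<close>

lemma DomL_square_dense:
  assumes "\<psi> \<in> DomL" "e > 0"
  obtains \<phi> where "\<phi> \<in> DomL" "L \<phi> \<in> DomL" "norm (\<psi> - \<phi>) < e"
proof -
  have "((\<lambda>h. integral {0..h} (\<lambda>t. T t \<psi>) /\<^sub>R h) \<longlongrightarrow> \<psi>) (at_right 0)"
    using integral_T_right_derivative[of 0 \<psi>] by (simp add: T_0)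
  from tendstoD[OF this assms(2)]
  have "\<forall>\<^sub>F h in at_right 0. norm (\<psi> - integral {0..h} (\<lambda>t. T t \<psi>) /\<^sub>R h) < e"
    by (simp add: dist_norm norm_minus_commute)
  then have "\<forall>\<^sub>F h in at_right 0. norm (\<psi> - integral {0..h} (\<lambda>t. T t \<psi>) /\<^sub>R h) < e \<and> h > (0::real)"
    using eventually_at_right_less[of "0::real"] by (rule eventually_conj)
  then obtain h :: real where h: "norm (\<psi> - integral {0..h} (\<lambda>t. T t \<psi>) /\<^sub>R h) < e" "h > 0"
    using eventually_happens'[OF trivial_limit_at_right_real[of 0]] by blast
  show ?thesis
    by (rule that[of "integral {0..h} (\<lambda>t. T t \<psi>) /\<^sub>R h"])
      (use h assms in \<open>auto intro!: generator_scaleR generator_diff generator_T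
        simp: generator_scaleR generator_integral_T\<close>)
qed

end

section \<open>The core and the convergence of the discrete resolvents\<close>

locale chernoff_approximation = contraction_semigroup T L DomL
  for T :: "real \<Rightarrow> 'a::banach \<Rightarrow> 'a" and L DomL +
  fixes F :: "real \<Rightarrow> 'a \<Rightarrow> 'a"
  assumes F_contraction: "\<And>t. t \<ge> 0 \<Longrightarrow> contraction (F t)"
    and chernoff: "chernoff_equivalent F T"
begin

lemma F_0: "F 0 = id"
  using chernoff by (simp add: chernoff_equivalent_def)

text \<open>The derivative of \<open>F\<close> at 0 is known only on a core. Density of its graph in
  the graph of the generator approximates \<open>\<phi>\<close> and \<open>L \<phi>\<close>
  simultaneously.\<close>

lemma core_approximation:
  assumes "\<phi> \<in> DomL" "e > 0"
  obtains \<eta> where "((\<lambda>t. (F t \<eta> - \<eta>) /\<^sub>R t) \<longlongrightarrow> L \<eta>) (at_right 0)"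
    "norm (\<eta> - \<phi>) < e" "norm (L \<eta> - L \<phi>) < e"
proof -
  obtain L' DomL' C where gen': "is_generator T L' DomL'" and C: "C \<subseteq> DomL'"
    and lim: "\<And>\<phi>. \<phi> \<in> C \<Longrightarrow> ((\<lambda>t. (F t \<phi> - \<phi>) /\<^sub>R t) \<longlongrightarrow> L' \<phi>) (at_right 0)"
    and core: "closure (op_graph L' C) = op_graph L' DomL'"
    using chernoff unfolding chernoff_equivalent_def by blast
  \<comment> \<open>Chernoff equivalence supplies its own generator pair. Uniqueness of limits
    identifies it with \<open>L\<close> on the common domain; outside the domain the two functions
    may differ.\<close>
  have LL': "L' \<phi> = L \<phi>" if "\<phi> \<in> DomL'" for \<phi>
    using gen' that generatorI(2)[of \<phi> "L' \<phi>"] by (simp add: is_generator_def)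
  have "DomL' = DomL" using gen' generator by (simp add: is_generator_def)
  then have "(\<phi>, L' \<phi>) \<in> closure (op_graph L' C)"
    unfolding core using assms by (simp add: op_graph_def)
  then obtain q where q: "q \<in> op_graph L' C" "dist q (\<phi>, L' \<phi>) < e"
    using assms(2) unfolding closure_approachable by blast
  then obtain \<eta> where \<eta>: "\<eta> \<in> C" "q = (\<eta>, L' \<eta>)" by (auto simp: op_graph_def)
  show ?thesis
  proof (rule that)
    show "((\<lambda>t. (F t \<eta> - \<eta>) /\<^sub>R t) \<longlongrightarrow> L \<eta>) (at_right 0)"
      using lim[OF \<eta>(1)] LL' \<eta> C by auto
    show "norm (\<eta> - \<phi>) < e"
      using dist_fst_le[of q "(\<phi>, L' \<phi>)"] q(2) \<eta>(2) by (simp add: dist_norm)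
    show "norm (L \<eta> - L \<phi>) < e"
      using dist_snd_le[of q "(\<phi>, L' \<phi>)"] q(2) \<eta> C LL' \<open>DomL' = DomL\<close> assms(1)
      by (auto simp: dist_norm)
  qed
qed

text \<open>The operator $(1 - (F(h) - 1)/h)^{-1}$.\<close>

definition resolvent :: "real \<Rightarrow> 'a \<Rightarrow> 'a" where
  "resolvent h = (SOME R. contraction R \<and> (\<forall>v. (1 + h) *\<^sub>R R v = h *\<^sub>R v + F h (R v)))"

lemma resolvent:
  assumes "h > 0"
  shows "contraction (resolvent h)" "(1 + h) *\<^sub>R resolvent h v = h *\<^sub>R v + F h (resolvent h v)"
  using someI_ex[OF resolvent_exists[OF F_contraction assms]] assms
  unfolding resolvent_def by auto

text \<open>For \<open>\<eta>\<close> in the core near \<open>\<phi>\<close> in the graph norm,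
  \<open>resolvent_error\<close> compares the resolvent of \<open>\<phi> - L \<phi>\<close> with
  \<open>\<eta>\<close>; its right-hand side is small because the quotient
  \<open>(F h \<eta> - \<eta>) /\<^sub>R h\<close> tends to \<open>L \<eta>\<close>.\<close>

lemma resolvent_tendsto:
  assumes "\<phi> \<in> DomL"
  shows "((\<lambda>h. resolvent h (\<phi> - L \<phi>)) \<longlongrightarrow> \<phi>) (at_right 0)"
proof (rule tendstoI)
  fix e :: real assume e: "e > 0"
  \<comment> \<open>Four quarters of \<open>e\<close> are spent: one on the quotient, one on
    \<open>L \<eta> - L \<phi>\<close> and two on \<open>\<eta> - \<phi>\<close>, which enters both
    in the resolvent bound and in the return from \<open>\<eta>\<close> to
    \<open>\<phi>\<close>.\<close>
  obtain \<eta> where lim: "((\<lambda>t. (F t \<eta> - \<eta>) /\<^sub>R t) \<longlongrightarrow> L \<eta>) (at_right 0)"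
    and \<eta>: "norm (\<eta> - \<phi>) < e / 4" "norm (L \<eta> - L \<phi>) < e / 4"
    using core_approximation[OF assms, of "e / 4"] e by auto
  from tendstoD[OF lim, of "e / 4"] e
  have "\<forall>\<^sub>F h in at_right 0. dist ((F h \<eta> - \<eta>) /\<^sub>R h) (L \<eta>) < e / 4" by simp
  then show "\<forall>\<^sub>F h in at_right 0. dist (resolvent h (\<phi> - L \<phi>)) \<phi> < e"
    using eventually_at_right_less[of "0::real"]
  proof eventually_elim
    case (elim h)
    let ?r = "resolvent h (\<phi> - L \<phi>)" and ?A = "(F h \<eta> - \<eta>) /\<^sub>R h"
    have "norm (?r - \<eta>) \<le> norm (\<phi> - L \<phi> - \<eta> + ?A)"
      using elim(2) by (intro resolvent_error[OF F_contraction] resolvent) auto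
    also have "\<phi> - L \<phi> - \<eta> + ?A = (?A - L \<eta>) + (L \<eta> - L \<phi>) - (\<eta> - \<phi>)"
      by simp
    also have "norm \<dots> \<le> norm (?A - L \<eta>) + norm (L \<eta> - L \<phi>) + norm (\<eta> - \<phi>)"
      by (meson add_right_mono norm_triangle_ineq norm_triangle_ineq4 order_trans)
    finally have "norm (?r - \<eta>) \<le> norm (?A - L \<eta>) + norm (L \<eta> - L \<phi>) + norm (\<eta> - \<phi>)" .
    moreover have "norm (?r - \<phi>) \<le> norm (?r - \<eta>) + norm (\<eta> - \<phi>)"
      using norm_triangle_ineq[of "?r - \<eta>" "\<eta> - \<phi>"] by simp
    ultimately show ?case using elim(1) \<eta> unfolding dist_norm by linarith
  qed
qed

text \<open>The pointwise limit is \<open>resolvent_tendsto\<close> at \<open>T s \<phi>\<close>.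
  Contractivity of the resolvents makes the difference Lipschitz in the pair
  \<open>(T s (\<phi> - L \<phi>), T s \<phi>)\<close> with a constant independent of
  \<open>h\<close>, and this pair is continuous in \<open>s\<close>.\<close>

lemma resolvent_T_uniform:
  assumes "\<phi> \<in> DomL" "e > 0"
  shows "\<forall>\<^sub>F h in at_right 0. \<forall>s\<in>{0..r}. norm (resolvent h (T s (\<phi> - L \<phi>)) - T s \<phi>) < e"
proof (rule equicontinuous_imp_uniformly_small[where C = 2 and m = "\<lambda>s. (T s (\<phi> - L \<phi>), T s \<phi>)"])
  show "continuous_on {0..r} (\<lambda>s. (T s (\<phi> - L \<phi>), T s \<phi>))"
    by (intro continuous_on_Pair continuous_on_T) auto
  show "((\<lambda>h. resolvent h (T s (\<phi> - L \<phi>)) - T s \<phi>) \<longlongrightarrow> 0) (at_right 0)" if "s \<in> {0..r}" for s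
  proof -
    have "((\<lambda>h. resolvent h (T s \<phi> - L (T s \<phi>))) \<longlongrightarrow> T s \<phi>) (at_right 0)"
      using that assms by (intro resolvent_tendsto generator_T) auto
    moreover have "T s \<phi> - L (T s \<phi>) = T s (\<phi> - L \<phi>)"
      using that assms by (simp add: generator_T T_diff)
    ultimately show ?thesis by (simp add: LIM_zero_iff)
  qed
  show "\<forall>\<^sub>F h in at_right 0. \<forall>s\<in>{0..r}. \<forall>s'\<in>{0..r}.
      norm (resolvent h (T s (\<phi> - L \<phi>)) - T s \<phi> - (resolvent h (T s' (\<phi> - L \<phi>)) - T s' \<phi>))
        \<le> 2 * dist (T s (\<phi> - L \<phi>), T s \<phi>) (T s' (\<phi> - L \<phi>), T s' \<phi>)"
    using eventually_at_right_less[of "0::real"]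
  proof eventually_elim
    case (elim h)
    show ?case
    proof (intro ballI)
      fix s s'
      let ?p = "T s (\<phi> - L \<phi>)" and ?p' = "T s' (\<phi> - L \<phi>)" and ?q = "T s \<phi>" and ?q' = "T s' \<phi>"
      have "resolvent h ?p - ?q - (resolvent h ?p' - ?q') = resolvent h (?p - ?p') - (?q - ?q')"
        by (simp add: linear_diff[OF contraction_linear[OF resolvent(1)[OF elim]]])
      also have "norm \<dots> \<le> norm (resolvent h (?p - ?p')) + norm (?q - ?q')"
        by (rule norm_triangle_ineq4)
      also have "\<dots> \<le> dist ?p ?p' + dist ?q ?q'"
        using contraction_norm_le[OF resolvent(1)[OF elim], of "?p - ?p'"] by (simp add: dist_norm)
      also have "\<dots> \<le> 2 * dist (?p, ?q) (?p', ?q')"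
        using dist_fst_le[of "(?p, ?q)" "(?p', ?q')"] dist_snd_le[of "(?p, ?q)" "(?p', ?q')"] by simp
      finally show "norm (resolvent h ?p - ?q - (resolvent h ?p' - ?q')) \<le> 2 * dist (?p, ?q) (?p', ?q')" .
    qed
  qed
qed (use assms in auto)

section \<open>Consistency and stability along an orbit\<close>

text \<open>Write \<open>u\<close> for the resolvent of \<open>T s \<psi>\<close>. The resolvent
  equation reads \<open>F h u = u + h *\<^sub>R (u - T s \<psi>)\<close>, while passing to time
  \<open>s + h\<close> adds \<open>h\<close> times the resolvent of \<open>T s\<close> applied to
  the difference quotient of \<open>\<psi>\<close>. Inserting
  \<open>\<psi> = \<phi> - L \<phi>\<close> splits the discrepancy into \<open>h\<close> times three
  terms, one for each smallness assumption.\<close>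

lemma one_step_error:
  assumes \<phi>: "\<phi> \<in> DomL" "L \<phi> \<in> DomL" and h: "h > 0" and s: "s \<ge> 0"
    and \<psi>: "\<psi> = \<phi> - L \<phi>"
    and 1: "norm ((T h \<psi> - \<psi>) /\<^sub>R h - L \<psi>) < e"
    and 2: "norm (resolvent h (T s \<psi>) - T s \<phi>) < e"
    and 3: "norm (resolvent h (T s (L \<psi>)) - T s (L \<phi>)) < e"
  shows "norm (F h (resolvent h (T s \<psi>)) - resolvent h (T (s + h) \<psi>)) \<le> h * (3 * e)"
proof -
  let ?R = "resolvent h" and ?d = "(T h \<psi> - \<psi>) /\<^sub>R h"
  note lin = contraction_linear[OF resolvent(1)[OF h]]
  have Fu: "F h (?R (T s \<psi>)) = (1 + h) *\<^sub>R ?R (T s \<psi>) - h *\<^sub>R T s \<psi>"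
    using resolvent(2)[OF h] by (simp add: algebra_simps)
  have step: "?R (T (s + h) \<psi>) = ?R (T s \<psi>) + h *\<^sub>R ?R (T s ?d)"
  proof -
    have "?R (T (s + h) \<psi>) - ?R (T s \<psi>) = ?R (T s (h *\<^sub>R ?d))"
      using h s by (simp add: T_add T_diff linear_diff[OF lin])
    then show ?thesis
      using h s by (simp add: T_scaleR linear_scale[OF lin] del: scaleR_scaleR divideR_right)
         (simp add: algebra_simps)
  qed
  have "F h (?R (T s \<psi>)) - ?R (T (s + h) \<psi>) =
      h *\<^sub>R ((?R (T s \<psi>) - T s \<phi>) - (?R (T s (?d - L \<psi>))) - (?R (T s (L \<psi>)) - T s (L \<phi>)))"
  proof -
    have 1: "T s \<psi> = T s \<phi> - T s (L \<phi>)" using s by (simp add: \<psi> T_diff)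
    have 2: "?R (T s (?d - L \<psi>)) = ?R (T s ?d) - ?R (T s (L \<psi>))"
      using s by (simp only: T_diff linear_diff[OF lin])
    have "(1 + h) *\<^sub>R u - h *\<^sub>R (x - y) - (u + h *\<^sub>R w)
        = h *\<^sub>R ((u - x) - (w - v) - (v - y))" for u v w x y :: 'a
      by (simp add: algebra_simps)
    then show ?thesis unfolding Fu step 2 unfolding 1 .
  qed
  also have "norm \<dots> \<le> h * (norm (?R (T s \<psi>) - T s \<phi>) + norm (?R (T s (?d - L \<psi>)))
      + norm (?R (T s (L \<psi>)) - T s (L \<phi>)))"
    unfolding norm_scaleR using h
    by (intro mult_mono) (auto intro: order_trans[OF norm_triangle_ineq4] add_right_mono)
  also have "\<dots> \<le> h * (e + e + e)"
  proof -
    have "norm (?R (T s (?d - L \<psi>))) \<le> norm (?d - L \<psi>)"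
      using contraction_norm_le[OF resolvent(1)[OF h]] T_norm_le[OF s] order_trans by blast
    then show ?thesis using 1 2 3 h by (intro mult_left_mono add_mono) auto
  qed
  finally show ?thesis by simp
qed

lemma chernoff_uniform_DomL_square:
  assumes \<phi>: "\<phi> \<in> DomL" "L \<phi> \<in> DomL" and r: "r \<ge> 0" and e: "e > 0"
  shows "\<forall>\<^sub>F n in sequentially. \<forall>\<tau>\<in>{0..r}. norm ((F (\<tau> / real n) ^^ n) \<phi> - T \<tau> \<phi>) < e"
proof -
  define \<psi> where "\<psi> = \<phi> - L \<phi>"
  \<comment> \<open>Telescoping costs at most \<open>3 * r * d\<close>, and replacing the orbit by
    resolvents at its two ends costs less than \<open>d\<close> each; the total stays below
    \<open>(3 + 3 * r) * d = e\<close>.\<close>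
  define d where "d = e / (3 + 3 * r)"
  have d: "d > 0" using e r by (simp add: d_def)
  have \<psi>_dom: "\<psi> \<in> DomL" and L\<psi>: "L \<psi> = L \<phi> - L (L \<phi>)"
    using generator_diff[OF \<phi>] by (simp_all add: \<psi>_def)
  have "\<forall>\<^sub>F h in at_right 0. norm ((T h \<psi> - \<psi>) /\<^sub>R h - L \<psi>) < d"
    using tendstoD[OF generator_tendsto[OF \<psi>_dom] d] by (simp add: dist_norm)
  moreover have "\<forall>\<^sub>F h in at_right 0. \<forall>s\<in>{0..r}. norm (resolvent h (T s \<psi>) - T s \<phi>) < d"
    unfolding \<psi>_def using \<phi>(1) d by (rule resolvent_T_uniform)
  \<comment> \<open>Since \<open>L \<psi> = L \<phi> - L (L \<phi>)\<close>, this is the same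
    convergence with \<open>L \<phi>\<close> in place of \<open>\<phi>\<close>; here
    \<open>L \<phi> \<in> DomL\<close> enters.\<close>
  moreover have "\<forall>\<^sub>F h in at_right 0. \<forall>s\<in>{0..r}. norm (resolvent h (T s (L \<psi>)) - T s (L \<phi>)) < d"
    unfolding L\<psi> using \<phi>(2) d by (rule resolvent_T_uniform)
  ultimately have "\<forall>\<^sub>F h in at_right 0. norm ((T h \<psi> - \<psi>) /\<^sub>R h - L \<psi>) < d \<and>
      (\<forall>s\<in>{0..r}. norm (resolvent h (T s \<psi>) - T s \<phi>) < d) \<and>
      (\<forall>s\<in>{0..r}. norm (resolvent h (T s (L \<psi>)) - T s (L \<phi>)) < d)"
    by (intro eventually_conj)
  then obtain b where b: "b > 0" and small: "\<And>h. 0 < h \<Longrightarrow> h < b \<Longrightarrow> norm ((T h \<psi> - \<psi>) /\<^sub>R h - L \<psi>) < d \<and>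
      (\<forall>s\<in>{0..r}. norm (resolvent h (T s \<psi>) - T s \<phi>) < d) \<and>
      (\<forall>s\<in>{0..r}. norm (resolvent h (T s (L \<psi>)) - T s (L \<phi>)) < d)"
    unfolding eventually_at_right_field by blast
  \<comment> \<open>All step sizes \<open>\<tau> / real n\<close> with \<open>\<tau> \<le> r\<close>
    are at most \<open>r / real n\<close>, so one threshold for \<open>n\<close> serves every
    \<open>\<tau>\<close>.\<close>
  have "((\<lambda>n. r / real n) \<longlongrightarrow> 0) sequentially"
    by (rule lim_const_over_n)
  from order_tendstoD(2)[OF this b] eventually_gt_at_top[of 0]
  show ?thesis
  proof eventually_elim
    case (elim n)
    show ?case
    proof
      fix \<tau> assume \<tau>: "\<tau> \<in> {0..r}"
      show "norm ((F (\<tau> / real n) ^^ n) \<phi> - T \<tau> \<phi>) < e"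
      \<comment> \<open>At \<open>\<tau> = 0\<close> the step size vanishes and the resolvent
        estimates do not apply, but both operators are the identity.\<close>
      proof (cases "\<tau> = 0")
        case True
        then show ?thesis using e by (simp add: F_0 T_0)
      next
        case False
        define h where "h = \<tau> / real n"
        have h: "h > 0" "real n * h = \<tau>" using False \<tau> elim by (auto simp: h_def)
        have "h \<le> r / real n" using \<tau> by (simp add: h_def divide_right_mono)
        with elim have hb: "h < b" by simp
        note small = small[OF h(1) hb]
        define u where "u k = resolvent h (T (real k * h) \<psi>)" for k
        \<comment> \<open>The grid points up to index \<open>n\<close> end at \<open>\<tau>\<close>
          and hence stay inside the interval of the uniform estimates.\<close>
        have k: "real k * h \<in> {0..r}" if "k \<le> n" for k
        proof -
          have "real k * h \<le> real n * h" using that h by (intro mult_right_mono) auto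
          then show ?thesis using h \<tau> by auto
        qed
        have "norm ((F h ^^ n) (u 0) - u n) \<le> real n * (h * (3 * d))"
        proof (rule contraction_telescope[OF F_contraction])
          fix k assume "k < n"
          then have s: "real k * h \<in> {0..r}" using k by simp
          have "norm (F h (resolvent h (T (real k * h) \<psi>)) - resolvent h (T (real k * h + h) \<psi>)) \<le> h * (3 * d)"
            using small s h \<phi> by (intro one_step_error) (auto simp: \<psi>_def)
          then show "norm (F h (u k) - u (Suc k)) \<le> h * (3 * d)"
            by (simp add: u_def algebra_simps)
        qed (use h in auto)
        also have "\<dots> = \<tau> * (3 * d)" using h(2) by (simp flip: mult.assoc)
        also have "\<dots> \<le> r * (3 * d)" using \<tau> d by (intro mult_right_mono) auto
        finally have 1: "norm ((F h ^^ n) (u 0) - u n) \<le> 3 * r * d" by simp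
        have 2: "norm (u n - T \<tau> \<phi>) < d"
          using small \<tau> h(2) by (simp add: u_def)
        have Fn: "contraction (F h ^^ n)" using F_contraction h by (simp add: contraction_funpow)
        have "norm ((F h ^^ n) \<phi> - (F h ^^ n) (u 0)) \<le> norm (u 0 - \<phi>)"
          using contraction_norm_le[OF Fn, of "\<phi> - u 0"]
          by (simp add: linear_diff[OF contraction_linear[OF Fn]] norm_minus_commute)
        also have "norm (u 0 - \<phi>) < d"
          using bspec[OF conjunct1[OF conjunct2[OF small]], of 0] r by (simp add: u_def T_0)
        finally have 3: "norm ((F h ^^ n) \<phi> - (F h ^^ n) (u 0)) < d" .
        have "norm ((F h ^^ n) \<phi> - T \<tau> \<phi>) \<le> norm ((F h ^^ n) \<phi> - (F h ^^ n) (u 0))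
            + norm ((F h ^^ n) (u 0) - u n) + norm (u n - T \<tau> \<phi>)"
          using norm_triangle_ineq[of "(F h ^^ n) \<phi> - (F h ^^ n) (u 0) + ((F h ^^ n) (u 0) - u n)" "u n - T \<tau> \<phi>"]
            norm_triangle_ineq[of "(F h ^^ n) \<phi> - (F h ^^ n) (u 0)" "(F h ^^ n) (u 0) - u n"]
          by simp
        also have "\<dots> < d + 3 * r * d + d" using 1 2 3 by linarith
        also have "\<dots> \<le> (3 + 3 * r) * d" using d by (simp add: algebra_simps)
        also have "\<dots> = e" using r by (simp add: d_def)
        finally show ?thesis by (simp add: h_def)
      qed
    qed
  qed
qed

text \<open>The result for the domain of the squared generator extends by density, because the
  powers of \<open>F\<close> and the semigroup are contractions and each moves the approximation
  error by less than \<open>e / 3\<close>.\<close>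

theorem chernoff_uniform:
  assumes "\<phi> \<in> DomL" and r: "r \<ge> 0" and e: "e > 0"
  shows "\<forall>\<^sub>F n in sequentially. \<forall>\<tau>\<in>{0..r}. norm ((F (\<tau> / real n) ^^ n) \<phi> - T \<tau> \<phi>) < e"
proof -
  obtain \<eta> where \<eta>: "\<eta> \<in> DomL" "L \<eta> \<in> DomL" "norm (\<phi> - \<eta>) < e / 3"
    using DomL_square_dense[OF assms(1), of "e / 3"] e by auto
  from e have "e / 3 > 0" by simp
  from chernoff_uniform_DomL_square[OF \<eta>(1,2) r this] show ?thesis
  proof eventually_elim
    case (elim n)
    show ?case
    proof
      fix \<tau> assume \<tau>: "\<tau> \<in> {0..r}"
      let ?F = "F (\<tau> / real n) ^^ n"
      have Fn: "contraction ?F" using F_contraction \<tau> by (simp add: contraction_funpow)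
      have "?F \<phi> - T \<tau> \<phi> = ?F (\<phi> - \<eta>) + (?F \<eta> - T \<tau> \<eta>) - T \<tau> (\<phi> - \<eta>)"
        using \<tau> by (simp add: T_diff linear_diff[OF contraction_linear[OF Fn]])
      also have "norm \<dots> \<le> norm (?F (\<phi> - \<eta>)) + norm (?F \<eta> - T \<tau> \<eta>) + norm (T \<tau> (\<phi> - \<eta>))"
        by (meson add_right_mono norm_triangle_ineq norm_triangle_ineq4 order_trans)
      also have "\<dots> < e / 3 + e / 3 + e / 3"
        using bspec[OF elim \<tau>] \<eta>(3) contraction_norm_le[OF Fn, of "\<phi> - \<eta>"] T_norm_le[of \<tau> "\<phi> - \<eta>"] \<tau>
        by auto
      finally show "norm (?F \<phi> - T \<tau> \<phi>) < e" by simp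
    qed
  qed
qed

end

section \<open>Estimates for Bochner integrals\<close>

text \<open>The triangle inequality for \<open>s - t\<close> through \<open>g\<close> and
  \<open>h\<close> is integrated. With \<open>g = h\<close> and \<open>b = 0\<close> it gives the
  Cauchy property of approximating integrals; in the limit it compares two Bochner
  integrals.\<close>

lemma simple_bochner_integral_diff_norm_le:
  fixes g h :: "'w \<Rightarrow> 'a::real_normed_vector"
  assumes sm: "strongly_measurable M g" "strongly_measurable M h"
    and s: "Bochner_Integration.simple_bochner_integrable M s"
    and t: "Bochner_Integration.simple_bochner_integrable M t"
    and b[measurable]: "b \<in> borel_measurable M"
    and le: "\<And>x. x \<in> space M \<Longrightarrow> ennreal (norm (g x - h x)) \<le> b x"
  shows "ennreal (norm (Bochner_Integration.simple_bochner_integral M s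
        - Bochner_Integration.simple_bochner_integral M t))
    \<le> (\<integral>\<^sup>+x. norm (g x - s x) \<partial>M) + (\<integral>\<^sup>+x. norm (h x - t x) \<partial>M) + (\<integral>\<^sup>+x. b x \<partial>M)"
    (is "ennreal ?d \<le> ?a + ?b + _")
proof -
  have sf: "simple_function M s" "simple_function M t"
    using s t by (auto elim: Bochner_Integration.simple_bochner_integrable.cases)
  \<comment> \<open>The norms \<open>norm (g x - s x)\<close> are only almost everywhere equal to
    measurable functions, so additivity of the integral is applied to the measurable versions
    \<open>h'\<close> and \<open>k\<close>.\<close>
  obtain h' where h[measurable]: "h' \<in> borel_measurable M" and h': "AE x in M. ennreal (norm (g x - s x)) = h' x"
    using strongly_measurable_norm_diff[OF sm(1) sf(1)] .
  obtain k where k[measurable]: "k \<in> borel_measurable M" and k': "AE x in M. ennreal (norm (h x - t x)) = k x"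
    using strongly_measurable_norm_diff[OF sm(2) sf(2)] .
  have st: "Bochner_Integration.simple_bochner_integrable M (\<lambda>x. s x - t x)"
    using s t by (rule simple_bochner_integrable_compose2[of "\<lambda>a b. a - b", rotated 1]) simp
  then have nst: "Bochner_Integration.simple_bochner_integrable M (\<lambda>x. norm (s x - t x))"
    using simple_bochner_integrable_compose2[of "\<lambda>a b. norm a", OF _ st st] by simp
  have "?d \<le> Bochner_Integration.simple_bochner_integral M (\<lambda>x. norm (s x - t x))"
    using simple_bochner_integral_norm_bound[OF st] simple_bochner_integral_diff[OF s t]
    by simp
  then have "ennreal (?d) \<le> ennreal (Bochner_Integration.simple_bochner_integral M (\<lambda>x. norm (s x - t x)))"
    by (rule ennreal_leI)
  also have "\<dots> = (\<integral>\<^sup>+x. norm (s x - t x) \<partial>M)"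
    by (rule simple_bochner_integral_eq_nn_integral[OF nst]) simp
  also have "\<dots> \<le> (\<integral>\<^sup>+x. (h' x + k x) + b x \<partial>M)"
  proof (rule nn_integral_mono_AE)
    show "AE x in M. ennreal (norm (s x - t x)) \<le> h' x + k x + b x"
      using h' k' AE_space
    proof eventually_elim
      case (elim x)
      have "norm (s x - t x) \<le> norm (g x - s x) + norm (h x - t x) + norm (g x - h x)"
        by (smt (verit, ccfv_SIG) add_diff_cancel_left' diff_add_cancel diff_diff_eq2 norm_diff_triangle_ineq norm_minus_commute norm_triangle_sub)
      then have "ennreal (norm (s x - t x)) \<le> ennreal (norm (g x - s x)) + ennreal (norm (h x - t x)) + ennreal (norm (g x - h x))"
        by (simp add: ennreal_leI flip: ennreal_plus)
      also have "\<dots> \<le> h' x + k x + b x"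
        using le[OF elim(3)] elim(1,2) by (simp add: add_left_mono)
      finally show ?case .
    qed
  qed
  also have "\<dots> = (\<integral>\<^sup>+x. h' x \<partial>M) + (\<integral>\<^sup>+x. k x \<partial>M) + (\<integral>\<^sup>+x. b x \<partial>M)"
    by (simp add: nn_integral_add)
  also have "(\<integral>\<^sup>+x. h' x \<partial>M) = ?a"
    using h' by (intro nn_integral_cong_AE) auto
  also have "(\<integral>\<^sup>+x. k x \<partial>M) = ?b"
    using k' by (intro nn_integral_cong_AE) auto
  finally show ?thesis .
qed

text \<open>The estimate for simple functions is applied along the two approximating sequences,
  whose error integrals vanish in the limit. The integrals are compared directly, without forming an
  integral of \<open>g - h\<close>.\<close>

lemma has_bochner_diff_norm_le:
  fixes g h :: "'w \<Rightarrow> 'a::real_normed_vector"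
  assumes "has_bochner M g y" "has_bochner M h z"
    and b[measurable]: "b \<in> borel_measurable M"
    and le: "\<And>x. x \<in> space M \<Longrightarrow> ennreal (norm (g x - h x)) \<le> b x"
  shows "ennreal (norm (y - z)) \<le> (\<integral>\<^sup>+x. b x \<partial>M)"
proof -
  obtain s where s: "\<And>i. Bochner_Integration.simple_bochner_integrable M (s i)"
      "(\<lambda>i. \<integral>\<^sup>+x. norm (g x - s i x) \<partial>M) \<longlonglongrightarrow> 0"
      "(\<lambda>i. Bochner_Integration.simple_bochner_integral M (s i)) \<longlonglongrightarrow> y"
    and sm: "strongly_measurable M g"
    using assms(1) unfolding has_bochner_def by blast
  obtain t where t: "\<And>i. Bochner_Integration.simple_bochner_integrable M (t i)"
      "(\<lambda>i. \<integral>\<^sup>+x. norm (h x - t i x) \<partial>M) \<longlonglongrightarrow> 0"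
      "(\<lambda>i. Bochner_Integration.simple_bochner_integral M (t i)) \<longlonglongrightarrow> z"
    and sm': "strongly_measurable M h"
    using assms(2) unfolding has_bochner_def by blast
  let ?a = "\<lambda>i. \<integral>\<^sup>+x. norm (g x - s i x) \<partial>M" and ?b = "\<lambda>i. \<integral>\<^sup>+x. norm (h x - t i x) \<partial>M"
  let ?d = "\<lambda>i. norm (Bochner_Integration.simple_bochner_integral M (s i) - Bochner_Integration.simple_bochner_integral M (t i))"
  have bound: "ennreal (?d i) \<le> ?a i + ?b i + (\<integral>\<^sup>+x. b x \<partial>M)" for i
    using sm sm' s(1) t(1) b le by (rule simple_bochner_integral_diff_norm_le)
  have lim: "(\<lambda>i. ?a i + ?b i + (\<integral>\<^sup>+x. b x \<partial>M)) \<longlonglongrightarrow> 0 + 0 + (\<integral>\<^sup>+x. b x \<partial>M)"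
    by (intro tendsto_add s(2) t(2) tendsto_const)
  have "?d \<longlonglongrightarrow> norm (y - z)"
    using s(3) t(3) by (intro tendsto_intros)
  then have "(\<lambda>i. ennreal (?d i)) \<longlonglongrightarrow> ennreal (norm (y - z))"
    by (intro tendsto_ennrealI)
  from LIMSEQ_le[OF this lim] bound show ?thesis by auto
qed

text \<open>Dominated convergence with a constant bound on a finite measure makes the error
  integrals vanish; the integrals of the simple functions are then Cauchy and converge by
  completeness.\<close>

lemma bochner_integrable_bounded_limit:
  fixes g :: "'w \<Rightarrow> 'a::banach"
  assumes fin: "finite_measure M" and u: "\<And>i. simple_function M (u i)"
    and lim: "\<And>x. x \<in> space M \<Longrightarrow> (\<lambda>i. u i x) \<longlonglongrightarrow> g x"
    and bd: "\<And>i x. x \<in> space M \<Longrightarrow> norm (u i x) \<le> C"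
  shows "bochner_integrable M g"
proof -
  interpret finite_measure M by fact
  have C: "norm (g x) \<le> C" if "x \<in> space M" for x
    by (rule LIMSEQ_le_const2[OF tendsto_norm[OF lim[OF that]]]) (use bd that in auto)
  have sm: "strongly_measurable M g"
    unfolding strongly_measurable_def using u lim by (intro exI[of _ u]) auto
  have sb: "Bochner_Integration.simple_bochner_integrable M (u i)" for i
    using u by (intro Bochner_Integration.simple_bochner_integrable.intros) (auto simp: emeasure_eq_measure)
  let ?I = "\<lambda>i. Bochner_Integration.simple_bochner_integral M (u i)"
  let ?a = "\<lambda>i. \<integral>\<^sup>+x. norm (g x - u i x) \<partial>M"
  have a: "?a \<longlonglongrightarrow> 0"
  proof -
    \<comment> \<open>The limsup of norms of simple functions is visibly measurable and agrees with
      \<open>norm (g x - u i x)\<close> on the space.\<close>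
    define v where "v i x = limsup (\<lambda>j. ennreal (norm (u j x - u i x)))" for i x
    have v: "v i \<in> borel_measurable M" for i
    proof -
      have "simple_function M (\<lambda>x. ennreal (norm (u j x - u i x)))" for j
        by (rule simple_function_compose2[OF u u, where h = "\<lambda>a b. ennreal (norm (a - b))"])
      then have "(\<lambda>x. ennreal (norm (u j x - u i x))) \<in> borel_measurable M" for j
        by (rule borel_measurable_simple_function)
      then show ?thesis unfolding v_def by (rule borel_measurable_limsup)
    qed
    have veq: "v i x = ennreal (norm (g x - u i x))" if "x \<in> space M" for i x
      unfolding v_def by (rule lim_imp_Limsup) (auto intro!: tendsto_intros lim[OF that])
    have "(\<lambda>i. \<integral>\<^sup>+x. v i x \<partial>M) \<longlonglongrightarrow> (\<integral>\<^sup>+x. 0 \<partial>M)"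
    proof (rule nn_integral_dominated_convergence)
      show "(\<integral>\<^sup>+x. ennreal (2 * C) \<partial>M) < \<infinity>"
        by (simp add: nn_integral_const emeasure_eq_measure ennreal_mult_less_top)
      show "AE x in M. v i x \<le> ennreal (2 * C)" for i
      proof (rule AE_I2)
        fix x assume x: "x \<in> space M"
        have "norm (g x - u i x) \<le> 2 * C"
          using C[OF x] bd[OF x, of i] norm_triangle_ineq4[of "g x" "u i x"] by linarith
        then show "v i x \<le> ennreal (2 * C)" by (simp add: veq[OF x] ennreal_leI)
      qed
      show "AE x in M. (\<lambda>i. v i x) \<longlonglongrightarrow> 0"
      proof (rule AE_I2)
        fix x assume x: "x \<in> space M"
        have "(\<lambda>i. norm (g x - u i x)) \<longlonglongrightarrow> norm (g x - g x)"
          by (intro tendsto_intros lim x)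
        from tendsto_ennrealI[OF this] show "(\<lambda>i. v i x) \<longlonglongrightarrow> 0"
          by (simp add: veq[OF x])
      qed
    qed (use v in auto)
    also have "(\<lambda>i. \<integral>\<^sup>+x. v i x \<partial>M) = ?a"
      by (intro ext nn_integral_cong) (simp add: veq)
    finally show ?thesis by simp
  qed
  have "Cauchy ?I"
  proof (rule metric_CauchyI)
    fix e :: real assume e: "e > 0"
    have "\<forall>\<^sub>F i in sequentially. ?a i < ennreal (e/2)"
      using order_tendstoD(2)[OF a] e by simp
    then obtain N where N: "\<And>i. i \<ge> N \<Longrightarrow> ?a i < ennreal (e/2)"
      unfolding eventually_sequentially by blast
    have "dist (?I m) (?I n) < e" if mn: "m \<ge> N" "n \<ge> N" for m n
    proof -
      \<comment> \<open>Here \<open>g\<close> is compared with itself, with dominating function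
        0.\<close>
      have "ennreal (dist (?I m) (?I n)) \<le> ?a m + ?a n + (\<integral>\<^sup>+x. 0 \<partial>M)"
        unfolding dist_norm using sm sm sb sb by (rule simple_bochner_integral_diff_norm_le) auto
      also have "\<dots> = ?a m + ?a n" by simp
      also have "?a m + ?a n < ennreal (e/2) + ennreal (e/2)"
        using N mn by (intro add_strict_mono) auto
      also have "\<dots> = ennreal e" using e by (simp flip: ennreal_plus)
      finally show ?thesis by (simp add: ennreal_less_iff)
    qed
    then show "\<exists>N. \<forall>m\<ge>N. \<forall>n\<ge>N. dist (?I m) (?I n) < e" by blast
  qed
  then obtain y where "?I \<longlonglongrightarrow> y"
    using Cauchy_convergent convergent_def by blast
  with sm sb a show ?thesis
    unfolding bochner_integrable_def has_bochner_def by blast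
qed

text \<open>Composing \<open>g\<close> with real simple functions that converge to the identity
  gives simple functions with values in the Banach space, convergent by continuity of
  \<open>g\<close>.\<close>

lemma bochner_integrable_continuous:
  fixes g :: "real \<Rightarrow> 'a::banach"
  assumes "finite_measure N" and sets: "sets N = sets (restrict_space borel {0..})"
    and g: "continuous_on {0..} g" and C: "\<And>x. x \<ge> 0 \<Longrightarrow> norm (g x) \<le> C"
  shows "bochner_integrable N g"
proof -
  have sp: "space N = {0..}"
    using sets_eq_imp_space_eq[OF sets] by (simp add: space_restrict_space)
  have "(\<lambda>x. x) \<in> borel_measurable N"
    by (subst measurable_cong_sets[OF sets refl]) (intro borel_measurable_continuous_on_restrict continuous_intros)
  then obtain v where v: "\<And>i. simple_function N (v i)" "\<And>x. x \<ge> 0 \<Longrightarrow> (\<lambda>i. v i x) \<longlonglongrightarrow> (x::real)"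
    using borel_measurable_implies_sequence_metric[of "\<lambda>x. x" N 0] sp by auto
  show ?thesis
  \<comment> \<open>The approximants \<open>v i x\<close> of a nonnegative number may be negative;
    clipping at 0 keeps them where \<open>g\<close> is known to be continuous and bounded.\<close>
  proof (rule bochner_integrable_bounded_limit[where u = "\<lambda>i x. g (max 0 (v i x))" and C = C])
    show "simple_function N (\<lambda>x. g (max 0 (v i x)))" for i
      using simple_function_compose[OF v(1)[of i], of "\<lambda>y. g (max 0 y)"] by (simp add: o_def)
    show "(\<lambda>i. g (max 0 (v i x))) \<longlonglongrightarrow> g x" if "x \<in> space N" for x
    proof (rule continuous_on_tendsto_compose[OF g])
      have "(\<lambda>i. max 0 (v i x)) \<longlonglongrightarrow> max 0 x"
        using that sp by (intro tendsto_max tendsto_const v) auto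
      then show "(\<lambda>i. max 0 (v i x)) \<longlonglongrightarrow> x" using that sp by (simp add: max_def)
    qed (use that sp in auto)
  qed (use assms in auto)
qed

section \<open>Tails of inverse subordinators\<close>

text \<open>With a countable basis, the complement of the support is a countable union of basic open
  null sets.\<close>

lemma measure_support_compl_null:
  fixes \<mu> :: "'a::second_countable_topology measure"
  assumes "sets \<mu> = sets borel"
  shows "- measure_support \<mu> \<in> null_sets \<mu>"
proof -
  obtain B :: "'a set set" where B: "countable B" "topological_basis B"
    using ex_countable_basis by blast
  have "- measure_support \<mu> = \<Union>{U \<in> B. emeasure \<mu> U = 0}"
  proof (intro equalityI subsetI)
    fix x assume "x \<in> - measure_support \<mu>"
    then obtain U where U: "open U" "x \<in> U" "emeasure \<mu> U = 0"
      by (auto simp: measure_support_def)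
    then obtain V where V: "V \<in> B" "x \<in> V" "V \<subseteq> U"
      using B(2) by (meson topological_basisE)
    then have "emeasure \<mu> V \<le> emeasure \<mu> U"
      using U assms by (intro emeasure_mono) auto
    then show "x \<in> \<Union>{U \<in> B. emeasure \<mu> U = 0}" using U V by auto
  next
    fix x assume "x \<in> \<Union>{U \<in> B. emeasure \<mu> U = 0}"
    then show "x \<in> - measure_support \<mu>"
      using topological_basis_open[OF B(2)] by (auto simp: measure_support_def)
  qed
  moreover have "(\<Union>U\<in>{U \<in> B. emeasure \<mu> U = 0}. U) \<in> null_sets \<mu>"
  proof (rule null_sets_UN')
    show "countable {U \<in> B. emeasure \<mu> U = 0}"
      using B(1) by (rule countable_subset[rotated]) auto
    show "U \<in> null_sets \<mu>" if "U \<in> {U \<in> B. emeasure \<mu> U = 0}" for U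
      using that topological_basis_open[OF B(2)] assms by auto
  qed
  ultimately show ?thesis by simp
qed

text \<open>At \<open>s = 1\<close> the integrand is constantly 1, so the value is the mass of
  \<open>{0..1}\<close>, which carries all of the nonzero measure \<open>\<mu>\<close>.\<close>

lemma bernstein_fn_1_pos:
  assumes "sets \<mu> = sets borel" "finite_measure \<mu>" "emeasure \<mu> (space \<mu>) \<noteq> 0"
    and "measure_support \<mu> \<subseteq> {0..1}"
  shows "bernstein_fn \<mu> 1 > 0"
proof -
  interpret finite_measure \<mu> by fact
  have sp: "space \<mu> = UNIV"
    using sets_eq_imp_space_eq[OF assms(1)] by simp
  have "bernstein_fn \<mu> 1 = measure \<mu> {0..1}"
    using assms(1) by (simp add: bernstein_fn_def set_lebesgue_integral_def sp)
  moreover have "emeasure \<mu> {0..1} \<noteq> 0"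
  proof
    assume 0: "emeasure \<mu> {0..1} = 0"
    have "- {0..1} \<in> null_sets \<mu>"
      by (rule null_sets_subset[OF measure_support_compl_null[OF assms(1)]]) (use assms in auto)
    moreover have "{0..1} \<in> null_sets \<mu>" using 0 assms by auto
    ultimately have "{0..1} \<union> - {0..1} \<in> null_sets \<mu>" by blast
    then show False using assms sp by auto
  qed
  ultimately show ?thesis
    by (simp add: emeasure_eq_measure less_le)
qed

section \<open>The laws of the inverse process on the half-line\<close>

lemma sets_density_measure: "sets (density_measure p t) = sets (restrict_space borel {0..})"
  by (simp add: density_measure_def sets_restrict_space)

lemma space_density_measure: "space (density_measure p t) = {0..}"
  by (simp add: density_measure_def space_restrict_space)

lemma emeasure_density_measure:
  assumes "distributed M lborel (E t) (\<lambda>x. ennreal (p t x))" "t > 0" "A \<in> sets borel" "A \<subseteq> {0..}"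
  shows "emeasure (density_measure p t) A = emeasure M (E t -` A \<inter> space M)"
proof -
  have [measurable]: "(\<lambda>x. ennreal (p t x)) \<in> borel_measurable borel"
    using assms(1) by (auto simp: distributed_def)
  have E: "E t \<in> measurable M lborel" and eq: "distr M lborel (E t) = density lborel (\<lambda>x. ennreal (p t x))"
    using assms(1) by (auto simp: distributed_def)
  have A: "A \<in> sets (restrict_space lborel {0..})"
    using assms(3,4) by (simp add: sets_restrict_space_iff)
  have "emeasure (density_measure p t) A = (\<integral>\<^sup>+x. ennreal (p t x) * indicator A x \<partial>restrict_space lborel {0..})"
    using assms(2) A by (simp add: density_measure_def emeasure_density measurable_restrict_space1)
  also have "\<dots> = (\<integral>\<^sup>+x. ennreal (p t x) * indicator A x * indicator {0..} x \<partial>lborel)"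
    by (subst nn_integral_restrict_space) auto
  also have "\<dots> = (\<integral>\<^sup>+x. ennreal (p t x) * indicator A x \<partial>lborel)"
    using assms(4) by (intro nn_integral_cong) (auto simp: indicator_def)
  also have "\<dots> = emeasure (distr M lborel (E t)) A"
    using assms(3) unfolding eq by (subst emeasure_density) auto
  also have "\<dots> = emeasure M (E t -` A \<inter> space M)"
    using E assms(3) by (subst emeasure_distr) auto
  finally show ?thesis .
qed

lemma emeasure_density_measure_le_1:
  assumes "prob_space M" "marginal_density M E p" "t \<ge> 0"
  shows "emeasure (density_measure p t) {0..} \<le> 1"
proof (cases "t = 0")
  case True
  then show ?thesis
    by (simp add: density_measure_def emeasure_return sets_restrict_space_iff)
next
  case False
  then have "emeasure (density_measure p t) {0..} = emeasure M (E t -` {0..} \<inter> space M)"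
    using assms by (intro emeasure_density_measure) (auto simp: marginal_density_def)
  also have "\<dots> \<le> 1"
    using assms(1) by (rule prob_space.measure_le_1)
  finally show ?thesis .
qed

text \<open>This is Markov's inequality for \<open>exp (- D r \<omega>)\<close>, whose expectation
  is the Laplace transform at 1.\<close>

lemma subordinator_lower_tail:
  assumes sub: "subordinator M D" and corr: "corresponds_to M D \<Phi>" and r: "r \<ge> 0"
  shows "measure M {\<omega> \<in> space M. D r \<omega> \<le> t} \<le> exp (t - r * \<Phi> 1)"
proof -
  interpret prob_space M using sub by (simp add: subordinator_def levy_process_def)
  have exp: "expectation (\<lambda>\<omega>. exp (- D r \<omega>)) = exp (- r * \<Phi> 1)"
    using corr[unfolded corresponds_to_def, rule_format, of 1 r] r by simp
  \<comment> \<open>A non-integrable function would have expectation 0 by convention, whereas the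
    value here is an exponential and hence nonzero.\<close>
  then have int: "integrable M (\<lambda>\<omega>. exp (- D r \<omega>))"
    using not_integrable_integral_eq by fastforce
  have "{\<omega> \<in> space M. D r \<omega> \<le> t} = {\<omega> \<in> space M. exp (- t) \<le> exp (- D r \<omega>)}" by auto
  also have "measure M \<dots> \<le> expectation (\<lambda>\<omega>. exp (- D r \<omega>)) / exp (- t)"
    by (rule integral_Markov_inequality_measure[where A = "space M"]) (use int in auto)
  also have "\<dots> = exp (t - r * \<Phi> 1)"
    unfolding exp by (simp add: exp_diff exp_minus field_simps)
  finally show ?thesis .
qed

text \<open>
  This includes paths that never exceed $t$, whose value of the inverse process is arbitrary.
\<close>

lemma inverse_process_upper_tail:
  assumes "r \<ge> 0" "inverse_process D t \<omega> > r"
  shows "D r \<omega> \<le> t"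
proof (rule ccontr)
  assume "\<not> D r \<omega> \<le> t"
  then have "Inf {\<tau>. 0 \<le> \<tau> \<and> D \<tau> \<omega> > t} \<le> r"
    using assms(1) by (intro cInf_lower) (auto intro!: bdd_belowI[of _ 0])
  with assms(2) show False by (simp add: inverse_process_def)
qed

text \<open>The event that the inverse process at \<open>t\<close> exceeds \<open>r\<close> lies in
  the event \<open>D r \<omega> \<le> t\<close>. For \<open>t = 0\<close> the Dirac measure at 0
  gives no mass to \<open>{r<..}\<close>. The bound increases with \<open>t\<close>, hence is
  uniform for bounded \<open>t\<close>.\<close>

lemma density_measure_tail:
  assumes sub: "subordinator M D" and corr: "corresponds_to M D \<Phi>"
    and p: "marginal_density M (inverse_process D) p" and t: "t \<ge> 0" and r: "r \<ge> 0"
  shows "emeasure (density_measure p t) {r<..} \<le> ennreal (exp (t - r * \<Phi> 1))"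
proof (cases "t = 0")
  case True
  then show ?thesis
    using r by (subst density_measure_def) (simp add: emeasure_return sets_restrict_space_iff subset_iff)
next
  case False
  interpret prob_space M using sub by (simp add: subordinator_def levy_process_def)
  have [measurable]: "D r \<in> borel_measurable M"
    using sub r by (simp add: subordinator_def levy_process_def)
  have "emeasure (density_measure p t) {r<..} = emeasure M (inverse_process D t -` {r<..} \<inter> space M)"
    using p t r False by (intro emeasure_density_measure) (auto simp: marginal_density_def)
  also have "\<dots> \<le> emeasure M {\<omega> \<in> space M. D r \<omega> \<le> t}"
    using inverse_process_upper_tail[OF r] by (intro emeasure_mono) auto
  also have "\<dots> \<le> ennreal (exp (t - r * \<Phi> 1))"
    unfolding emeasure_eq_measure by (intro ennreal_leI subordinator_lower_tail sub corr r)
  finally show ?thesis .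
qed

section \<open>Convergence of the subordinate approximations\<close>

theorem theorem4p1:
  fixes T F :: "real \<Rightarrow> 'a::banach \<Rightarrow> 'a"
    and L :: "'a \<Rightarrow> 'a" and DomL :: "'a set" and f0 :: 'a
    and \<mu> :: "real measure"
    and M :: "'w measure" and D E :: "real \<Rightarrow> 'w \<Rightarrow> real"
    and p :: "real \<Rightarrow> real \<Rightarrow> real"
    and f :: "real \<Rightarrow> 'a" and fn :: "nat \<Rightarrow> real \<Rightarrow> 'a"
  assumes "strongly_continuous_semigroup T"
    and "\<And>t. t \<ge> 0 \<Longrightarrow> contraction (T t)"
    and "is_generator T L DomL"
    and "\<And>t. t \<ge> 0 \<Longrightarrow> contraction (F t)"
    and "\<And>\<phi>. (\<lambda>t. norm (F t \<phi>)) \<in> borel_measurable (restrict_space borel {0..})"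
    and "chernoff_equivalent F T"
    and "f0 \<in> DomL"
    and "sets \<mu> = sets borel" and "finite_measure \<mu>" and "emeasure \<mu> (space \<mu>) \<noteq> 0"
    and "measure_support \<mu> \<subseteq> {0<..<1}"
    and "subordinator M D" and "corresponds_to M D (bernstein_fn \<mu>)"
    and "E = inverse_process D"
    and "marginal_density M E p"
    and "\<And>t. t \<ge> 0 \<Longrightarrow> f t = subordinate_family T p t f0"
    and fn_well_defined: "\<And>n t. n \<ge> 1 \<Longrightarrow> t \<ge> 0 \<Longrightarrow>
          bochner_integrable (density_measure p t) (\<lambda>\<tau>. (F (\<tau> / real n) ^^ n) f0)"
    and "\<And>n t. n \<ge> 1 \<Longrightarrow> t \<ge> 0 \<Longrightarrow>
          fn n t = bochner_integral (density_measure p t) (\<lambda>\<tau>. (F (\<tau> / real n) ^^ n) f0)"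
  shows "\<forall>K. compact K \<and> K \<subseteq> {0..} \<longrightarrow>
           uniform_limit K (\<lambda>n t. norm (fn n t - f t)) (\<lambda>t. 0) sequentially"
proof (intro allI impI, elim conjE)
  fix K :: "real set" assume K: "compact K" "K \<subseteq> {0..}"
  interpret chernoff_approximation T L DomL F
    by unfold_locales (use assms(1-4,6) in auto)
  interpret prob_space M using assms(12) by (simp add: subordinator_def levy_process_def)
  define c where "c = bernstein_fn \<mu> 1"
  have c: "c > 0"
    unfolding c_def using assms(8-11) by (intro bernstein_fn_1_pos) auto
  obtain a where a: "\<And>t. t \<in> K \<Longrightarrow> t \<le> a"
    using compact_imp_bounded[OF K(1)] bounded_imp_bdd_above unfolding bdd_above_def by blast
  \<comment> \<open>The orbit of \<open>f0\<close> is continuous and bounded and the measure is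
    finite, so the integral defining \<open>f t\<close> exists and \<open>bochner_integral\<close>
    returns its genuine value.\<close>
  have has_f: "has_bochner (density_measure p t) (\<lambda>\<tau>. T \<tau> f0) (f t)" if t: "t \<ge> 0" for t
  proof -
    have "emeasure (density_measure p t) (space (density_measure p t)) \<le> 1"
      unfolding space_density_measure
      by (rule emeasure_density_measure_le_1[OF prob_space_axioms assms(15) t])
    then have "finite_measure (density_measure p t)"
      by (intro finite_measureI) (auto simp: top_unique)
    then have "bochner_integrable (density_measure p t) (\<lambda>\<tau>. T \<tau> f0)"
      by (rule bochner_integrable_continuous[OF _ sets_density_measure]) (auto intro: continuous_on_T T_norm_le)
    then show ?thesis
      using t assms(16) unfolding bochner_integrable_def subordinate_family_def
      by (metis bochner_integral_eq)
  qed
  have has_fn: "has_bochner (density_measure p t) (\<lambda>\<tau>. (F (\<tau> / real n) ^^ n) f0) (fn n t)"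
    if "n \<ge> 1" "t \<ge> 0" for n t
    using fn_well_defined[OF that] assms(18)[OF that] unfolding bochner_integrable_def
    by (metis bochner_integral_eq)
  show "uniform_limit K (\<lambda>n t. norm (fn n t - f t)) (\<lambda>t. 0) sequentially"
  proof (rule uniform_limitI)
    fix e :: real assume e: "e > 0"
    \<comment> \<open>The cutoff \<open>r\<close> is chosen from the tail bound at the upper bound
      \<open>a\<close> of \<open>K\<close>, before \<open>n\<close> and \<open>t\<close>, so that it
      serves all of them.\<close>
    have "((\<lambda>r. 2 * norm f0 * exp (a - r * c)) \<longlongrightarrow> 0) at_top"
      using c by real_asymp
    then have "\<forall>\<^sub>F r in at_top. 2 * norm f0 * exp (a - r * c) < e / 2"
      by (rule order_tendstoD) (use e in simp)
    then have "\<forall>\<^sub>F r in at_top. 2 * norm f0 * exp (a - r * c) < e / 2 \<and> r \<ge> (0::real)"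
      using eventually_ge_at_top[of 0] by (rule eventually_conj)
    then obtain r where r: "2 * norm f0 * exp (a - r * c) < e / 2" "r \<ge> 0"
      using eventually_happens'[OF trivial_limit_at_top_linorder] by blast
    have "e / 2 > 0" using e by simp
    from chernoff_uniform[OF assms(7) r(2) this] eventually_ge_at_top[of 1]
    show "\<forall>\<^sub>F n in sequentially. \<forall>t\<in>K. dist (norm (fn n t - f t)) 0 < e"
    proof eventually_elim
      case (elim n)
      show ?case
      proof
        fix t assume "t \<in> K"
        with K(2) a have t: "t \<ge> 0" "t \<le> a" by auto
        let ?N = "density_measure p t"
        \<comment> \<open>Up to \<open>r\<close> the Chernoff estimate bounds the integrand
          difference by \<open>e / 2\<close>; beyond \<open>r\<close> contractivity gives
          \<open>2 * norm f0\<close>, which is weighted by the small tail mass.\<close>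
        let ?b = "\<lambda>\<tau>. ennreal (e / 2) + ennreal (2 * norm f0) * indicator {r<..} \<tau>"
        have tail: "{r<..} \<in> sets ?N"
          unfolding sets_density_measure using r(2) by (auto simp: sets_restrict_space_iff)
        have "ennreal (norm (fn n t - f t)) \<le> (\<integral>\<^sup>+\<tau>. ?b \<tau> \<partial>?N)"
        proof (rule has_bochner_diff_norm_le[OF has_fn[OF elim(2) t(1)] has_f[OF t(1)]])
          show "?b \<in> borel_measurable ?N"
            using tail by measurable
          fix \<tau> assume "\<tau> \<in> space ?N"
          then have \<tau>: "\<tau> \<ge> 0" by (simp add: space_density_measure)
          show "ennreal (norm ((F (\<tau> / real n) ^^ n) f0 - T \<tau> f0)) \<le> ?b \<tau>"
          proof (cases "\<tau> \<le> r")
            case True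
            then have "norm ((F (\<tau> / real n) ^^ n) f0 - T \<tau> f0) \<le> e / 2"
              using elim(1) \<tau> by (intro less_imp_le) auto
            then show ?thesis using True by (simp add: ennreal_leI)
          next
            case False
            have "contraction (F (\<tau> / real n) ^^ n)"
              using \<tau> by (intro contraction_funpow F_contraction) auto
            from contraction_norm_le[OF this, of f0] T_norm_le[OF \<tau>, of f0]
            have "norm ((F (\<tau> / real n) ^^ n) f0 - T \<tau> f0) \<le> 2 * norm f0"
              using norm_triangle_ineq4[of "(F (\<tau> / real n) ^^ n) f0" "T \<tau> f0"] by simp
            then show ?thesis
              using False by (auto intro!: order_trans[OF ennreal_leI] simp: add_increasing)
          qed
        qed
        also have "\<dots> = ennreal (e / 2) * emeasure ?N {0..} + ennreal (2 * norm f0) * emeasure ?N {r<..}"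
          using tail by (simp add: nn_integral_add nn_integral_cmult_indicator space_density_measure)
        also have "\<dots> \<le> ennreal (e / 2) * 1 + ennreal (2 * norm f0) * ennreal (exp (t - r * c))"
          unfolding c_def using assms(12-15) t r(2) prob_space_axioms
          by (intro add_mono mult_left_mono density_measure_tail emeasure_density_measure_le_1) auto
        also have "\<dots> = ennreal (e / 2 + 2 * norm f0 * exp (t - r * c))"
          using e by (simp flip: ennreal_mult' ennreal_plus)
        finally have "norm (fn n t - f t) \<le> e / 2 + 2 * norm f0 * exp (t - r * c)"
          using e by (subst (asm) ennreal_le_iff) auto
        also have "\<dots> \<le> e / 2 + 2 * norm f0 * exp (a - r * c)"
          using t by (intro add_left_mono mult_left_mono) auto
        also have "\<dots> < e" using r(1) by simp
        finally show "dist (norm (fn n t - f t)) 0 < e" by simp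
      qed
    qed
  qed
qed

end
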